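(* Let $N\ge 1$ be an integer, let $\rho>0$, and let $$f(z)=\sum_{j=0}^{N-1}c_jz^{n_j}+c'z^M,\qquad n_0<n_1<\cdots<n_{N-1}<M,$$ with $c_0,\ldots,c_{N-1},c'\in\mathbb{R}$, and let the set of matrices $\mathcal{P}_0$, together with the exponents, be as in one of the settings (1)--(4) described in the context. Let $$\mathcal{C}=\mathcal{C}(f,\rho):=\sum_{j=0}^{N-1}\frac{V(\mathbf{n}_j)^2}{V(\mathbf{n})^2}\,\frac{\rho^{M-n_j}}{c_j},$$ where $\mathbf{n}:=(n_0,\ldots,n_{N-1})$ and $\mathbf{n}_j:=(n_0,\ldots,\widehat{n_j},\ldots,n_{N-1},M)$. Suppose that $c_0,\ldots,c_{N-1}>0$ and $c'>-\mathcal{C}^{-1}$. If all of the rows of $A\in\mathcal{P}_0$ are distinct, and $n_0=0$ when $A$ has a zero row, then $f[A]$ is positive definite.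
   Context: For $I\subseteq\mathbb{C}$ and positive integers $k\le N$, $\mathcal{P}_N^k(I)$ is the set of positive semidefinite (hence Hermitian) $N\times N$ matrices with entries in $I$ and rank at most $k$, and $\mathcal{P}_N(I):=\mathcal{P}_N^N(I)$. $\overline{D}(0,\rho)$ is the closed disc in $\mathbb{C}$ with center $0$ and radius $\rho$; $\mathbb{Z}_+$ is the set of non-negative integers. For a matrix $A=(a_{ij})$, $f[A]:=(f(a_{ij}))$ is obtained by applying $f$ to each entry. Convention: $0^0:=1$. In $\mathbf{n}_j$, $\widehat{n_j}$ indicates that $n_j$ is omitted. For an $N$-tuple $\mathbf{m}=(m_1,\ldots,m_N)$, $V(\mathbf{m}):=\prod_{1\le k<l\le N}(m_l-m_k)$ (empty product equal to $1$). Settings: (1) $\mathcal{P}_0=\mathcal{P}_N^1((0,\rho))$, with $n_0,\ldots,n_{N-1},M$ arbitrary real numbers. (2) $\mathcal{P}_N^1((0,\rho))\subseteq\mathcal{P}_0\subseteq\mathcal{P}_N^1([0,\rho])$, with $n_0,\ldots,n_{N-1},M$ non-negative real numbers. (3) $\mathcal{P}_N^1((0,\rho))\subseteq\mathcal{P}_0\subseteq\mathcal{P}_N([0,\rho])$, with $n_0,\ldots,n_{N-1},M\in\mathbb{Z}_+\cup[N-1,\infty)$. (4) $\mathcal{P}_N^1((0,\rho))\subseteq\mathcal{P}_0\subseteq\mathcal{P}_N(\overline{D}(0,\rho))$, with $n_0\in\mathbb{Z}_+$, $n_j=n_0+j$ for $j=0,\ldots,N-1$, and $M$ an integer. In all settings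 $n_0<\cdots<n_{N-1}<M$. *)

theory Defs
  imports
    "HOL-Analysis.Analysis"
    "Jordan_Normal_Form.DL_Rank"
    "Jordan_Normal_Form.Schur_Decomposition"
begin

text \<open>Matrices are those of \<^theory>\<open>Jordan_Normal_Form.Matrix\<close>. The order on the complex numbers
  is the one of \<^theory>\<open>HOL-Library.Complex_Order\<close>, in which \<open>0 \<le> z\<close> and \<open>0 < z\<close> imply that
  \<open>z\<close> is real.\<close>

definition hermitian_mat :: "nat \<Rightarrow> complex mat \<Rightarrow> bool" where
  "hermitian_mat N A \<longleftrightarrow> A \<in> carrier_mat N N \<and> mat_adjoint A = A"

definition pos_semidef :: "nat \<Rightarrow> complex mat \<Rightarrow> bool" where
  "pos_semidef N A \<longleftrightarrow> hermitian_mat N A \<and>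
     (\<forall>v \<in> carrier_vec N. 0 \<le> (A *\<^sub>v v) \<bullet>c v)"

definition pos_def :: "nat \<Rightarrow> complex mat \<Rightarrow> bool" where
  "pos_def N A \<longleftrightarrow> hermitian_mat N A \<and>
     (\<forall>v \<in> carrier_vec N. v \<noteq> 0\<^sub>v N \<longrightarrow> 0 < (A *\<^sub>v v) \<bullet>c v)"

definition psd_rank :: "nat \<Rightarrow> nat \<Rightarrow> complex set \<Rightarrow> complex mat set" where
  "psd_rank N k I = {A. pos_semidef N A \<and> elements_mat A \<subseteq> I \<and> vec_space.rank N A \<le> k}"

abbreviation psd :: "nat \<Rightarrow> complex set \<Rightarrow> complex mat set" where
  "psd N I \<equiv> psd_rank N N I"

text \<open>Powers with the convention that \<open>0\<close> to the power \<open>0\<close> is \<open>1\<close>, whereas the library has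
  \<open>0 powr 0 = 0\<close>. The lemmas show that this agrees with the usual powers where those are defined:
  natural exponents, real powers of positive reals, and positive powers of \<open>0\<close>.\<close>

definition cpow :: "complex \<Rightarrow> real \<Rightarrow> complex" where
  "cpow z a = (if a = 0 then 1 else z powr complex_of_real a)"

lemma cpow_nat: "cpow z (real k) = z ^ k"
  by (cases "z = 0") (auto simp: cpow_def powr_nat')

lemma cpow_of_real: "0 < x \<Longrightarrow> cpow (complex_of_real x) a = complex_of_real (x powr a)"
  by (auto simp: cpow_def powr_of_real)

lemma cpow_zero: "0 < a \<Longrightarrow> cpow 0 a = 0"
  by (simp add: cpow_def)

definition vdm :: "real list \<Rightarrow> real" where
  "vdm m = (\<Prod>l<length m. \<Prod>k<l. m ! l - m ! k)"

definition exps :: "nat \<Rightarrow> (nat \<Rightarrow> real) \<Rightarrow> real list" where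
  "exps N n = map n [0..<N]"

definition exps_omit :: "nat \<Rightarrow> (nat \<Rightarrow> real) \<Rightarrow> real \<Rightarrow> nat \<Rightarrow> real list" where
  "exps_omit N n M j = map n ([0..<j] @ [Suc j..<N]) @ [M]"

definition fewnomial ::
  "nat \<Rightarrow> (nat \<Rightarrow> real) \<Rightarrow> real \<Rightarrow> (nat \<Rightarrow> real) \<Rightarrow> real \<Rightarrow> complex \<Rightarrow> complex" where
  "fewnomial N n M c c' z =
     (\<Sum>j<N. complex_of_real (c j) * cpow z (n j)) + complex_of_real c' * cpow z M"

definition threshold ::
  "nat \<Rightarrow> (nat \<Rightarrow> real) \<Rightarrow> real \<Rightarrow> (nat \<Rightarrow> real) \<Rightarrow> real \<Rightarrow> real" where
  "threshold N n M c \<rho> =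
     (\<Sum>j<N. (vdm (exps_omit N n M j))\<^sup>2 / (vdm (exps N n))\<^sup>2 * (\<rho> powr (M - n j) / c j))"

definition setting1 :: "nat \<Rightarrow> real \<Rightarrow> complex mat set \<Rightarrow> bool" where
  "setting1 N \<rho> P0 \<longleftrightarrow> P0 = psd_rank N 1 (complex_of_real ` {0<..<\<rho>})"

definition setting2 :: "nat \<Rightarrow> real \<Rightarrow> (nat \<Rightarrow> real) \<Rightarrow> real \<Rightarrow> complex mat set \<Rightarrow> bool" where
  "setting2 N \<rho> n M P0 \<longleftrightarrow>
     psd_rank N 1 (complex_of_real ` {0<..<\<rho>}) \<subseteq> P0 \<and>
     P0 \<subseteq> psd_rank N 1 (complex_of_real ` {0..\<rho>}) \<and>
     (\<forall>j<N. n j \<ge> 0) \<and> M \<ge> 0"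

definition setting3 :: "nat \<Rightarrow> real \<Rightarrow> (nat \<Rightarrow> real) \<Rightarrow> real \<Rightarrow> complex mat set \<Rightarrow> bool" where
  "setting3 N \<rho> n M P0 \<longleftrightarrow>
     psd_rank N 1 (complex_of_real ` {0<..<\<rho>}) \<subseteq> P0 \<and>
     P0 \<subseteq> psd N (complex_of_real ` {0..\<rho>}) \<and>
     (\<forall>j<N. n j \<in> \<nat> \<union> {real N - 1..}) \<and> M \<in> \<nat> \<union> {real N - 1..}"

definition setting4 :: "nat \<Rightarrow> real \<Rightarrow> (nat \<Rightarrow> real) \<Rightarrow> real \<Rightarrow> complex mat set \<Rightarrow> bool" where
  "setting4 N \<rho> n M P0 \<longleftrightarrow>
     psd_rank N 1 (complex_of_real ` {0<..<\<rho>}) \<subseteq> P0 \<and>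
     P0 \<subseteq> psd N (cball 0 \<rho>) \<and>
     n 0 \<in> \<nat> \<and> (\<forall>j<N. n j = n 0 + real j) \<and> M \<in> \<int>"

end

theory Submission imports Defs begin

text \<open>Split \<open>f = \<epsilon> f\<^sub>0 + h\<close>, where \<open>f\<^sub>0\<close> is the part of \<open>f\<close> with the exponents \<open>n\<^sub>j\<close> and \<open>\<epsilon> > 0\<close> is
  so small that \<open>c'\<close> is still at least minus the reciprocal of the threshold of \<open>h\<close>, whose lower
  coefficients are \<open>(1 - \<epsilon>) c\<^sub>j\<close>. It then suffices that \<open>h[A]\<close> is positive semidefinite and that
  \<open>f\<^sub>0[A]\<close> is positive definite (\<open>pd_on_power_sum_split\<close>).

  Semidefiniteness is first shown for \<open>A = u u\<^sup>*\<close>. If the power \<open>M\<close> is interpolated at the entries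
  of \<open>u\<close> by \<open>\<Sum>j. x\<^sub>j z\<^bsup>n\<^sub>j\<^esup>\<close>, the quadratic form of \<open>h[A]\<close> becomes \<open>\<Sum>j. d\<^sub>j |y\<^sub>j|\<^sup>2 + c' |\<Sum>j. x\<^sub>j y\<^sub>j|\<^sup>2\<close> up
  to conjugation, \<open>d\<^sub>j\<close> being the lower coefficients of \<open>h\<close>, and the Cauchy-Schwarz inequality
  reduces the claim to a bound on \<open>|x\<^sub>j|\<close>. The sharp bound is the value reached
  when all nodes coincide at the largest admissible modulus, a product of the factors
  \<open>(M - n\<^sub>k) / |n\<^sub>j - n\<^sub>k|\<close> times a power of that modulus. For real nodes it follows from Rolle's
  theorem (\<open>powr_interpolation_bound\<close>): dividing the error by \<open>t\<^bsup>n\<^sub>k\<^esup>\<close> and differentiating removes the exponent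
  \<open>n\<^sub>k\<close> and one node, and produces exactly the factor for \<open>k\<close>. For complex nodes and consecutive exponents
  the \<open>x\<^sub>j\<close> are, up to sign, hook Schur polynomials, whose coefficients are nonnegative
  (\<open>complex_power_interpolation\<close>).

  Higher rank is reached by the method of FitzGerald and Horn. There is \<open>u\<close> such that \<open>A - u u\<^sup>*\<close> is
  positive semidefinite with a vanishing row, and along the segment from \<open>u u\<^sup>*\<close> to \<open>A\<close> the derivative
  of \<open>h[\<cdot>]\<close> is the Schur product of \<open>A - u u\<^sup>*\<close> with \<open>h'[\<cdot>]\<close>. This only involves the remaining
  rows, and on those \<open>h'\<close> is a harmless lowest power plus a function to which induction applies, because
  \<open>M\<close> times the threshold of the latter does not exceed the threshold of \<open>h\<close> (\<open>power_threshold_derivative\<close>).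

  For definiteness, the same monotonicity gives \<open>f\<^sub>0[A] \<ge> f\<^sub>0[u u\<^sup>*]\<close> for \<open>u = A w / \<surd>(w\<^sup>* A w)\<close>.
  Since the rows of \<open>A\<close> are distinct, a generic \<open>w\<close> makes the entries of \<open>u\<close> distinct,
  and then the powers \<open>n\<^sub>j\<close> can interpolate arbitrary data at these entries, which forces
  \<open>f\<^sub>0[u u\<^sup>*]\<close> to be positive definite. In the first two settings \<open>A\<close> itself has the form \<open>u u\<^sup>*\<close>.\<close>

section \<open>Quadratic forms and the Schur product\<close>

text \<open>Matrices are functions restricted to a finite index set, so that deleting a row and the
  corresponding column is just passing to a smaller set. All inductions on the size of a matrix below
  are inductions on this set.\<close>

definition qform :: "'i set \<Rightarrow> ('i \<Rightarrow> 'i \<Rightarrow> complex) \<Rightarrow> ('i \<Rightarrow> complex) \<Rightarrow> complex" where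
  "qform I a v = (\<Sum>i\<in>I. \<Sum>k\<in>I. a i k * v k * cnj (v i))"

text \<open>The defining equation is oriented so that it terminates as a rewrite rule.\<close>

definition herm_on :: "'i set \<Rightarrow> ('i \<Rightarrow> 'i \<Rightarrow> complex) \<Rightarrow> bool" where
  "herm_on I a \<longleftrightarrow> (\<forall>i\<in>I. \<forall>k\<in>I. cnj (a i k) = a k i)"

definition psd_on :: "'i set \<Rightarrow> ('i \<Rightarrow> 'i \<Rightarrow> complex) \<Rightarrow> bool" where
  "psd_on I a \<longleftrightarrow> herm_on I a \<and> (\<forall>v. 0 \<le> Re (qform I a v))"

definition pd_on :: "'i set \<Rightarrow> ('i \<Rightarrow> 'i \<Rightarrow> complex) \<Rightarrow> bool" where
  "pd_on I a \<longleftrightarrow> herm_on I a \<and> (\<forall>v. (\<exists>i\<in>I. v i \<noteq> 0) \<longrightarrow> 0 < Re (qform I a v))"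

lemma qform_add: "qform I (\<lambda>i k. a i k + b i k) v = qform I a v + qform I b v"
  by (simp add: qform_def algebra_simps sum.distrib)

lemma qform_diff: "qform I (\<lambda>i k. a i k - b i k) v = qform I a v - qform I b v"
  by (simp add: qform_def algebra_simps sum_subtractf)

lemma qform_scale: "qform I (\<lambda>i k. z * a i k) v = z * qform I a v"
  by (simp add: qform_def sum_distrib_left mult.assoc)

lemma qform_sum: "qform I (\<lambda>i k. \<Sum>j\<in>J. a j i k) v = (\<Sum>j\<in>J. qform I (a j) v)"
proof -
  have "qform I (\<lambda>i k. \<Sum>j\<in>J. a j i k) v = (\<Sum>i\<in>I. \<Sum>k\<in>I. \<Sum>j\<in>J. a j i k * v k * cnj (v i))"
    by (simp add: qform_def sum_distrib_right)
  also have "\<dots> = (\<Sum>i\<in>I. \<Sum>j\<in>J. \<Sum>k\<in>I. a j i k * v k * cnj (v i))"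
    by (intro sum.cong refl sum.swap)
  also have "\<dots> = (\<Sum>j\<in>J. qform I (a j) v)"
    unfolding qform_def by (rule sum.swap)
  finally show ?thesis .
qed

lemma qform_cong: "(\<And>i k. i \<in> I \<Longrightarrow> k \<in> I \<Longrightarrow> a i k = b i k) \<Longrightarrow> qform I a v = qform I b v"
  by (simp add: qform_def)

lemma qform_rank_one:
  "qform I (\<lambda>i k. u i * cnj (u k)) v = of_real ((cmod (\<Sum>k\<in>I. cnj (u k) * v k))\<^sup>2)"
proof -
  have "qform I (\<lambda>i k. u i * cnj (u k)) v
      = (\<Sum>i\<in>I. \<Sum>k\<in>I. (cnj (u k) * v k) * cnj (cnj (u i) * v i))"
    unfolding qform_def by (intro sum.cong refl) (simp add: algebra_simps)
  also have "\<dots> = (\<Sum>k\<in>I. cnj (u k) * v k) * cnj (\<Sum>k\<in>I. cnj (u k) * v k)"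
    by (subst sum.swap) (simp only: cnj_sum sum_product)
  finally show ?thesis by (simp only: complex_norm_square)
qed

lemma psd_on_cong:
  assumes "\<And>i k. i \<in> I \<Longrightarrow> k \<in> I \<Longrightarrow> a i k = b i k"
  shows "psd_on I a \<longleftrightarrow> psd_on I b"
proof -
  have "qform I a v = qform I b v" for v by (rule qform_cong) (rule assms)
  moreover have "herm_on I a \<longleftrightarrow> herm_on I b"
    unfolding herm_on_def by (intro ball_cong refl) (simp only: assms)
  ultimately show ?thesis by (simp add: psd_on_def)
qed

lemma pd_on_cong:
  assumes "\<And>i k. i \<in> I \<Longrightarrow> k \<in> I \<Longrightarrow> a i k = b i k"
  shows "pd_on I a \<longleftrightarrow> pd_on I b"
proof -
  have "qform I a v = qform I b v" for v by (rule qform_cong) (rule assms)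
  moreover have "herm_on I a \<longleftrightarrow> herm_on I b"
    unfolding herm_on_def by (intro ball_cong refl) (simp only: assms)
  ultimately show ?thesis by (simp add: pd_on_def)
qed

lemma psd_on_empty: "psd_on {} a"
  by (simp add: psd_on_def herm_on_def qform_def)

lemma psd_on_add: "psd_on I a \<Longrightarrow> psd_on I b \<Longrightarrow> psd_on I (\<lambda>i k. a i k + b i k)"
  by (simp add: psd_on_def herm_on_def qform_add)

lemma psd_on_scale: "0 \<le> (c::real) \<Longrightarrow> psd_on I a \<Longrightarrow> psd_on I (\<lambda>i k. of_real c * a i k)"
  by (simp add: psd_on_def herm_on_def qform_scale)

lemma psd_on_zero: "psd_on I (\<lambda>i k. 0)"
  by (simp add: psd_on_def herm_on_def qform_def)

lemma psd_on_sum: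
  assumes "\<And>j. j \<in> J \<Longrightarrow> psd_on I (a j)"
  shows "psd_on I (\<lambda>i k. \<Sum>j\<in>J. a j i k)"
proof -
  have "herm_on I (\<lambda>i k. \<Sum>j\<in>J. a j i k)"
    using assms unfolding herm_on_def psd_on_def by (auto intro!: sum.cong)
  moreover have "0 \<le> Re (qform I (\<lambda>i k. \<Sum>j\<in>J. a j i k) v)" for v
    using assms unfolding qform_sum Re_sum psd_on_def by (intro sum_nonneg) blast
  ultimately show ?thesis by (simp add: psd_on_def)
qed

lemma psd_on_rank_one: "psd_on I (\<lambda>i k. u i * cnj (u k))"
  unfolding psd_on_def qform_rank_one by (simp add: herm_on_def)

lemma pd_on_add_psd: "pd_on I a \<Longrightarrow> psd_on I b \<Longrightarrow> pd_on I (\<lambda>i k. a i k + b i k)"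
  by (auto simp: pd_on_def psd_on_def herm_on_def qform_add intro!: add_pos_nonneg)

lemma pd_on_scale: "0 < (c::real) \<Longrightarrow> pd_on I a \<Longrightarrow> pd_on I (\<lambda>i k. of_real c * a i k)"
  by (simp add: pd_on_def herm_on_def qform_scale)

lemma psd_on_subset:
  assumes "psd_on I a" "J \<subseteq> I" "finite I"
  shows "psd_on J a"
proof -
  have "qform J a v = qform I a (\<lambda>i. if i \<in> J then v i else 0)" for v
    unfolding qform_def using assms
    by (intro sum.mono_neutral_cong_left) (auto intro!: sum.mono_neutral_cong_left)
  moreover have "herm_on J a" using assms unfolding psd_on_def herm_on_def by blast
  ultimately show ?thesis using assms by (simp add: psd_on_def)
qed

lemma psd_on_extend_zero:
  assumes "psd_on (I - {p}) a" "finite I" "\<And>i. i \<in> I \<Longrightarrow> a i p = 0 \<and> a p i = 0"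
  shows "psd_on I a"
proof -
  have "qform (I - {p}) a v = qform I a v" for v
    unfolding qform_def using assms
    by (intro sum.mono_neutral_cong_left) (auto intro!: sum.mono_neutral_cong_left)
  moreover have "herm_on I a"
    unfolding herm_on_def
  proof (intro ballI)
    fix i k assume "i \<in> I" "k \<in> I"
    then show "cnj (a i k) = a k i"
      using assms by (cases "i = p \<or> k = p") (auto simp: psd_on_def herm_on_def)
  qed
  ultimately show ?thesis using assms by (auto simp: psd_on_def)
qed

lemma psd_on_diag:
  assumes "psd_on I a" "i \<in> I" "finite I"
  shows "0 \<le> Re (a i i)" and "Im (a i i) = 0"
proof -
  have "psd_on {i} a" using assms by (auto intro: psd_on_subset[OF assms(1)])
  then have "0 \<le> Re (qform {i} a (\<lambda>_. 1))" "cnj (a i i) = a i i"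
    by (auto simp: psd_on_def herm_on_def)
  then show "0 \<le> Re (a i i)" "Im (a i i) = 0"
    by (auto simp: qform_def complex_eq_iff)
qed

text \<open>This is the Cauchy-Schwarz inequality for the form of \<open>a\<close>: the square of the form between
  \<open>v\<close> and \<open>w\<close> is at most the product of its values at \<open>v\<close> and \<open>w\<close>. When the value at \<open>w\<close> is \<open>0\<close>,
  division by \<open>0\<close> makes \<open>u\<close> zero, which is the right choice because \<open>a w\<close> is zero as well.\<close>

lemma psd_on_diff_rank_one:
  fixes I :: "'i set" and a :: "'i \<Rightarrow> 'i \<Rightarrow> complex" and w :: "'i \<Rightarrow> complex"
  defines "s \<equiv> \<lambda>i. \<Sum>k\<in>I. a i k * w k"
  defines "u \<equiv> \<lambda>i. s i / of_real (sqrt (Re (qform I a w)))"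
  assumes "finite I" and psd: "psd_on I a"
  shows "psd_on I (\<lambda>i k. a i k - u i * cnj (u k))"
    and "Re (qform I a w) = 0 \<Longrightarrow> i \<in> I \<Longrightarrow> s i = 0"
proof -
  define q where "q = Re (qform I a w)"
  define B where "B v = (\<Sum>i\<in>I. s i * cnj (v i))" for v
  have herm: "cnj (a i k) = a k i" if "i \<in> I" "k \<in> I" for i k
    using psd that by (auto simp: psd_on_def herm_on_def)
  have q0: "q \<ge> 0" using psd by (simp add: q_def psd_on_def)
  have e1: "(\<Sum>i\<in>I. \<Sum>k\<in>I. a i k * w k * cnj (v i)) = B v" for v
    by (simp add: B_def s_def sum_distrib_right)
  have "(\<Sum>i\<in>I. \<Sum>k\<in>I. a i k * v k * cnj (w i)) = (\<Sum>k\<in>I. \<Sum>i\<in>I. cnj (a k i * w i * cnj (v k)))" for v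
    by (subst sum.swap) (intro sum.cong refl, simp add: herm)
  then have e2: "(\<Sum>i\<in>I. \<Sum>k\<in>I. a i k * v k * cnj (w i)) = cnj (B v)" for v
    by (simp only: e1[symmetric] cnj_sum)
  have expand: "qform I a (\<lambda>i. v i + z * w i)
      = qform I a v + z * B v + cnj z * cnj (B v) + (z * cnj z) * qform I a w" for v z
  proof -
    have "qform I a (\<lambda>i. v i + z * w i) = (\<Sum>i\<in>I. \<Sum>k\<in>I. a i k * v k * cnj (v i)
       + z * (a i k * w k * cnj (v i)) + cnj z * (a i k * v k * cnj (w i))
       + (z * cnj z) * (a i k * w k * cnj (w i)))"
      unfolding qform_def by (intro sum.cong refl) (simp add: algebra_simps)
    then show ?thesis
      by (simp add: sum.distrib e1 e2 qform_def flip: sum_distrib_left)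
  qed
  have ineq: "0 \<le> Re (qform I a v) - 2 * t * (cmod (B v))\<^sup>2 + t\<^sup>2 * (cmod (B v))\<^sup>2 * q" for v and t :: real
  proof -
    have "0 \<le> Re (qform I a (\<lambda>i. v i + (- of_real t * cnj (B v)) * w i))"
      using psd by (simp add: psd_on_def)
    also have "\<dots> = Re (qform I a v) - 2 * t * (cmod (B v))\<^sup>2 + t\<^sup>2 * (cmod (B v))\<^sup>2 * q"
      unfolding expand q_def cmod_power2 by (simp add: power2_eq_square algebra_simps)
    finally show ?thesis .
  qed
  have B0: "B v = 0" if "q = 0" for v
  proof (rule ccontr)
    assume "B v \<noteq> 0"
    then have b: "(cmod (B v))\<^sup>2 > 0" by simp
    \<comment> \<open>the quadratic bound is affine in \<open>t\<close> here, and this \<open>t\<close> makes it equal to \<open>-1\<close>\<close>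
    have "0 \<le> Re (qform I a v) - 2 * ((Re (qform I a v) + 1) / (2 * (cmod (B v))\<^sup>2)) * (cmod (B v))\<^sup>2"
      using ineq[of v "(Re (qform I a v) + 1) / (2 * (cmod (B v))\<^sup>2)"] that by simp
    then show False using b by (simp add: field_simps)
  qed
  show "s i = 0" if "Re (qform I a w) = 0" "i \<in> I"
  proof -
    have "B (\<lambda>k. if k = i then 1 else 0) = s i"
      using that \<open>finite I\<close> by (simp add: B_def if_distrib cong: if_cong)
    then show ?thesis using B0 that by (simp add: q_def)
  qed
  have "0 \<le> Re (qform I a v - qform I (\<lambda>i k. u i * cnj (u k)) v)" for v
  proof -
    have "(\<Sum>k\<in>I. cnj (u k) * v k) = cnj (B v) / of_real (sqrt q)"
      unfolding u_def B_def q_def[symmetric] by (simp add: sum_divide_distrib)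
    then have "(cmod (\<Sum>k\<in>I. cnj (u k) * v k))\<^sup>2 = (cmod (B v))\<^sup>2 / q"
      using q0 by (simp add: norm_divide power_divide)
    moreover have "(cmod (B v))\<^sup>2 / q \<le> Re (qform I a v)"
    proof (cases "q = 0")
      case True then show ?thesis using psd by (simp add: psd_on_def)
    next
      case False
      \<comment> \<open>the minimum of the quadratic bound is attained at \<open>t = 1 / q\<close>\<close>
      then show ?thesis using ineq[of v "1 / q"] q0 by (simp add: power2_eq_square field_simps)
    qed
    ultimately show ?thesis by (simp add: qform_rank_one)
  qed
  moreover have "herm_on I (\<lambda>i k. a i k - u i * cnj (u k))"
    using psd by (simp add: psd_on_def herm_on_def)
  ultimately show "psd_on I (\<lambda>i k. a i k - u i * cnj (u k))"
    by (simp add: psd_on_def qform_diff)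
qed

text \<open>For the unit vector \<open>w\<close> at \<open>p\<close> the difference loses its row and column at \<open>p\<close>, so a
  positive semidefinite matrix is a rank one matrix plus one of smaller size.\<close>

lemma psd_on_peel:
  assumes "finite I" "psd_on I a" "p \<in> I"
    and u_def: "\<And>i. u i = a i p / of_real (sqrt (Re (a p p)))"
  shows "psd_on I (\<lambda>i k. a i k - u i * cnj (u k))"
    and "i \<in> I \<Longrightarrow> a i p = u i * cnj (u p)"
    and "i \<in> I \<Longrightarrow> a p i = u p * cnj (u i)"
    and "i \<in> I \<Longrightarrow> (cmod (u i))\<^sup>2 \<le> cmod (a i i)"
proof -
  define w where "w = (\<lambda>k. if k = p then 1 else (0::complex))"
  have s: "(\<Sum>k\<in>I. a i k * w k) = a i p" for i
    using assms by (simp add: w_def if_distrib cong: if_cong)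
  have q: "qform I a w = a p p"
  proof -
    have "qform I a w = (\<Sum>i\<in>I. a i p * cnj (w i))"
      by (simp add: qform_def s flip: sum_distrib_right)
    then show ?thesis using assms by (simp add: w_def if_distrib cong: if_cong)
  qed
  have herm: "cnj (a i k) = a k i" if "i \<in> I" "k \<in> I" for i k
    using assms that by (auto simp: psd_on_def herm_on_def)
  show psd: "psd_on I (\<lambda>i k. a i k - u i * cnj (u k))"
    using psd_on_diff_rank_one(1)[OF assms(1,2), of w] unfolding s q u_def .
  have pp: "a p p = of_real (Re (a p p))" "0 \<le> Re (a p p)"
    using psd_on_diag[OF assms(2,3,1)] by (auto simp: complex_eq_iff)
  have zero: "a i p = 0" if "Re (a p p) = 0" "i \<in> I" for i
    using psd_on_diff_rank_one(2)[OF assms(1,2), of w i] that unfolding s q by simp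
  have "u i * cnj (u p) = a i p * (cnj (a p p) / of_real (Re (a p p)))" for i
    using pp(2) unfolding u_def by (simp add: of_real_mult[symmetric] del: of_real_mult)
  moreover have "cnj (a p p) = of_real (Re (a p p))"
    by (subst pp(1)) simp
  ultimately have *: "u i * cnj (u p) = a i p" if "i \<in> I" for i
    using zero[OF _ that] by (cases "Re (a p p) = 0") simp_all
  show "a i p = u i * cnj (u p)" if "i \<in> I" using * that by simp
  show "a p i = u p * cnj (u i)" if "i \<in> I"
  proof -
    have "a p i = cnj (u i * cnj (u p))" unfolding *[OF that] using herm[OF that assms(3)] by simp
    then show ?thesis by simp
  qed
  show "(cmod (u i))\<^sup>2 \<le> cmod (a i i)" if "i \<in> I"
  proof -
    have "0 \<le> Re (a i i - u i * cnj (u i))"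
      using psd_on_diag(1)[OF psd that assms(1)] .
    then have "(cmod (u i))\<^sup>2 \<le> Re (a i i)"
      by (simp add: cmod_power2) (simp add: power2_eq_square)
    then show ?thesis using complex_Re_le_cmod[of "a i i"] by linarith
  qed
qed

lemma qform_rank_one_mult:
  "qform I (\<lambda>i k. (u i * cnj (u k)) * b i k) v = qform I b (\<lambda>i. cnj (u i) * v i)"
  by (simp add: qform_def algebra_simps)

text \<open>Peel off one rank one summand of \<open>a\<close>: its Schur product with \<open>b\<close> is a congruence
  by a diagonal matrix, and the rest is smaller.\<close>

lemma psd_on_schur:
  assumes "finite I" "psd_on I a" "psd_on I b"
  shows "psd_on I (\<lambda>i k. a i k * b i k)"
  using assms
proof (induction I arbitrary: a rule: finite_induct)
  case empty
  show ?case by (rule psd_on_empty)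
next
  case (insert p I)
  define u where "u i = a i p / of_real (sqrt (Re (a p p)))" for i
  have fin: "finite (insert p I)" and pin: "p \<in> insert p I" using insert.hyps(1) by simp_all
  note peel = psd_on_peel[OF fin insert.prems(1) pin u_def]
  have 1: "psd_on (insert p I) (\<lambda>i k. (u i * cnj (u k)) * b i k)"
    using insert.prems(2) by (simp add: psd_on_def herm_on_def qform_rank_one_mult)
  have "psd_on I (\<lambda>i k. a i k - u i * cnj (u k))" "psd_on I b"
    by (rule psd_on_subset[OF _ subset_insertI fin], rule peel(1) insert.prems(2))+
  then have rest: "psd_on I (\<lambda>i k. (a i k - u i * cnj (u k)) * b i k)"
    by (rule insert.IH)
  have 2: "psd_on (insert p I) (\<lambda>i k. (a i k - u i * cnj (u k)) * b i k)"
  proof (rule psd_on_extend_zero[OF _ fin, where p = p])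
    have "insert p I - {p} = I" using insert.hyps by simp
    with rest show "psd_on (insert p I - {p}) (\<lambda>i k. (a i k - u i * cnj (u k)) * b i k)"
      by (simp only:)
  next
    fix i assume "i \<in> insert p I"
    then have "a i p - u i * cnj (u p) = 0" "a p i - u p * cnj (u i) = 0"
      using peel(2)[of i] peel(3)[of i] by simp_all
    then show "(a i p - u i * cnj (u p)) * b i p = 0 \<and> (a p i - u p * cnj (u i)) * b p i = 0"
      by simp
  qed
  have "(u i * cnj (u k)) * b i k + (a i k - u i * cnj (u k)) * b i k = a i k * b i k" for i k
    by (simp add: algebra_simps)
  then show ?case using psd_on_add[OF 1 2] by (simp only:)
qed

section \<open>Entrywise powers on the Loewner order\<close>

text \<open>On the segment from \<open>b\<close> to \<open>a\<close>, every quadratic form of \<open>f[\<cdot>]\<close> has as its derivative the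
  form of the Schur product of \<open>a - b\<close> and \<open>f'[\<cdot>]\<close>, which is nonnegative. Asking for the derivative only
  inside the segment admits powers that are not differentiable at \<open>0\<close>.\<close>

lemma psd_on_mono_by_derivative:
  fixes f f' :: "complex \<Rightarrow> complex"
  assumes "finite I" and psd: "psd_on I (\<lambda>i k. a i k - b i k)"
    and herm: "herm_on I (\<lambda>i k. f (a i k))" "herm_on I (\<lambda>i k. f (b i k))"
    and cont: "\<And>i k. i \<in> I \<Longrightarrow> k \<in> I \<Longrightarrow>
      continuous_on {0..1} (\<lambda>t. f (b i k + of_real t * (a i k - b i k)))"
    and deriv: "\<And>i k t. i \<in> I \<Longrightarrow> k \<in> I \<Longrightarrow> 0 < t \<Longrightarrow> t < 1 \<Longrightarrow>
      ((\<lambda>t. f (b i k + of_real t * (a i k - b i k))) has_vector_derivative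
        (a i k - b i k) * f' (b i k + of_real t * (a i k - b i k))) (at t)"
    and f': "\<And>t. 0 < t \<Longrightarrow> t < 1 \<Longrightarrow> psd_on I (\<lambda>i k. f' (b i k + of_real t * (a i k - b i k)))"
  shows "psd_on I (\<lambda>i k. f (a i k) - f (b i k))"
proof -
  have "0 \<le> Re (qform I (\<lambda>i k. f (a i k) - f (b i k)) v)" for v
  proof -
    define q where "q t = Re (qform I (\<lambda>i k. f (b i k + of_real t * (a i k - b i k))) v)" for t :: real
    have "q 0 \<le> q 1"
    proof (rule DERIV_nonneg_imp_increasing_open[where f = q])
      show "continuous_on {0..1} q"
        unfolding q_def qform_def Re_sum using cont by (intro continuous_intros) auto
      fix t :: real assume t: "0 < t" "t < 1"
      define d where "d = Re (qform I (\<lambda>i k. (a i k - b i k) * f' (b i k + of_real t * (a i k - b i k))) v)"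
      have "(q has_vector_derivative d) (at t)"
        unfolding q_def d_def qform_def Re_sum
        by (intro has_vector_derivative_sum bounded_linear.has_vector_derivative[OF bounded_linear_Re]
              has_vector_derivative_mult_left deriv t)
      moreover have "0 \<le> d"
        using psd_on_schur[OF assms(1) psd f'[OF t]] by (simp add: psd_on_def d_def)
      ultimately show "\<exists>y. (q has_real_derivative y) (at t) \<and> 0 \<le> y"
        by (auto simp: has_real_derivative_iff_has_vector_derivative)
    qed simp
    then show ?thesis by (simp add: q_def qform_diff)
  qed
  then show ?thesis using herm by (simp add: psd_on_def herm_on_def)
qed

lemma cpow_nonneg_real: "0 \<le> x \<Longrightarrow> cpow (of_real x) \<alpha> = of_real (if \<alpha> = 0 then 1 else x powr \<alpha>)"
  by (cases "x = 0") (auto simp: cpow_def powr_of_real)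

lemma cpow_cnj: "\<alpha> \<in> \<nat> \<or> z \<in> \<real>\<^sub>\<ge>\<^sub>0 \<Longrightarrow> cpow (cnj z) \<alpha> = cnj (cpow z \<alpha>)"
  by (auto elim!: Nats_cases nonneg_Reals_cases simp: cpow_nat cpow_nonneg_real)

lemma cpow_mult:
  assumes "\<alpha> \<in> \<nat> \<or> z \<in> \<real>\<^sub>\<ge>\<^sub>0 \<and> w \<in> \<real>\<^sub>\<ge>\<^sub>0"
  shows "cpow (z * w) \<alpha> = cpow z \<alpha> * cpow w \<alpha>"
  using assms
proof
  assume "\<alpha> \<in> \<nat>"
  then show ?thesis by (auto elim!: Nats_cases simp: cpow_nat power_mult_distrib)
next
  assume "z \<in> \<real>\<^sub>\<ge>\<^sub>0 \<and> w \<in> \<real>\<^sub>\<ge>\<^sub>0"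
  then obtain x y where "z = of_real x" "w = of_real y" "0 \<le> x" "0 \<le> y"
    by (auto elim!: nonneg_Reals_cases)
  then show ?thesis
    using cpow_nonneg_real[of "x * y" \<alpha>] by (simp add: cpow_nonneg_real powr_mult)
qed

lemma cpow_rank_one:
  assumes "\<alpha> \<in> \<nat> \<or> z \<in> \<real>\<^sub>\<ge>\<^sub>0 \<and> w \<in> \<real>\<^sub>\<ge>\<^sub>0"
  shows "cpow (z * cnj w) \<alpha> = cpow z \<alpha> * cnj (cpow w \<alpha>)"
proof -
  have "w \<in> \<real>\<^sub>\<ge>\<^sub>0 \<Longrightarrow> cnj w \<in> \<real>\<^sub>\<ge>\<^sub>0" by (auto elim: nonneg_Reals_cases)
  then show ?thesis using assms by (auto simp: cpow_mult cpow_cnj)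
qed

text \<open>A segment between nonnegative reals is either constantly \<open>0\<close> or positive in its interior, so
  real exponents cause no trouble there. The exponent \<open>\<alpha> - 1\<close> may be negative.\<close>

lemma cpow_segment:
  assumes "\<alpha> \<in> \<nat> \<or> 0 \<le> \<alpha> \<and> p \<in> \<real>\<^sub>\<ge>\<^sub>0 \<and> q \<in> \<real>\<^sub>\<ge>\<^sub>0"
  shows "continuous_on {0..1} (\<lambda>t. cpow (p + of_real t * (q - p)) \<alpha>)" (is ?C)
    and "0 < t \<Longrightarrow> t < 1 \<Longrightarrow> ((\<lambda>t. cpow (p + of_real t * (q - p)) \<alpha>) has_vector_derivative
      (q - p) * (of_real \<alpha> * cpow (p + of_real t * (q - p)) (\<alpha> - 1))) (at t)" (is "_ \<Longrightarrow> _ \<Longrightarrow> ?D t")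
proof -
  have "?C \<and> (\<forall>t. 0 < t \<and> t < 1 \<longrightarrow> ?D t)"
  proof (cases "\<alpha> \<in> \<nat>")
    case True
    then obtain m where m: "\<alpha> = real m" by (auto elim: Nats_cases)
    have [simp]: "of_nat m * cpow z (real m - 1) = of_nat m * z ^ (m - 1)" for z
      by (cases m) (simp_all add: cpow_nat)
    have "?D t" for t
      unfolding m cpow_nat
      by (rule has_vector_derivative_eq_rhs, rule field_vector_diff_chain_at[unfolded o_def, where g = "\<lambda>z. z ^ m"])
         (auto intro!: derivative_eq_intros)
    moreover have ?C unfolding m cpow_nat by (intro continuous_intros)
    ultimately show ?thesis by blast
  next
    case False
    then obtain x y where xy: "p = of_real x" "q = of_real y" "0 \<le> x" "0 \<le> y" and \<alpha>: "0 < \<alpha>"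
      using assms by (auto elim!: nonneg_Reals_cases) (metis Nats_0 order_le_less)
    have nn: "0 \<le> x + t * (y - x)" if "0 \<le> t" "t \<le> 1" for t
    proof -
      have "x + t * (y - x) = (1 - t) * x + t * y" by (simp add: algebra_simps)
      then show ?thesis using that xy by simp
    qed
    have eq: "cpow (p + of_real t * (q - p)) \<alpha> = of_real ((x + t * (y - x)) powr \<alpha>)" if "0 \<le> t" "t \<le> 1" for t
      using cpow_nonneg_real[OF nn[OF that], of \<alpha>] \<alpha> by (simp add: xy)
    have C: ?C
    proof (subst continuous_on_cong[OF refl])
      show "cpow (p + of_real t * (q - p)) \<alpha> = of_real ((x + t * (y - x)) powr \<alpha>)" if "t \<in> {0..1}" for t
        using that eq by simp
      show "continuous_on {0..1} (\<lambda>t. complex_of_real ((x + t * (y - x)) powr \<alpha>))"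
        using nn \<alpha> by (intro continuous_intros continuous_on_powr') auto
    qed
    have "?D t" if t: "0 < t" "t < 1" for t
    proof (cases "x = 0 \<and> y = 0")
      case True
      then show ?thesis by (simp add: xy)
    next
      case False
      have pos: "0 < x + t * (y - x)"
      proof -
        have "0 < (1 - t) * x + t * y"
          using False xy t by (metis add_nonneg_pos add_pos_nonneg diff_gt_0_iff_gt less_eq_real_def mult_nonneg_nonneg mult_pos_pos)
        then show ?thesis by (simp add: algebra_simps)
      qed
      have "((\<lambda>t. (x + t * (y - x)) powr \<alpha>) has_real_derivative (y - x) * (\<alpha> * (x + t * (y - x)) powr (\<alpha> - 1))) (at t)"
        using pos by (auto intro!: derivative_eq_intros)
      then have "((\<lambda>t. complex_of_real ((x + t * (y - x)) powr \<alpha>)) has_vector_derivative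
          of_real ((y - x) * (\<alpha> * (x + t * (y - x)) powr (\<alpha> - 1)))) (at t)"
        by (intro has_vector_derivative_of_real) (simp add: has_real_derivative_iff_has_vector_derivative)
      moreover have "of_real ((y - x) * (\<alpha> * (x + t * (y - x)) powr (\<alpha> - 1)))
          = (q - p) * (of_real \<alpha> * cpow (p + of_real t * (q - p)) (\<alpha> - 1))"
        using cpow_of_real[OF pos, of "\<alpha> - 1"] by (simp add: xy)
      ultimately have "((\<lambda>t. complex_of_real ((x + t * (y - x)) powr \<alpha>)) has_vector_derivative
          (q - p) * (of_real \<alpha> * cpow (p + of_real t * (q - p)) (\<alpha> - 1))) (at t)" by (simp only:)
      then show ?thesis
      proof (rule has_vector_derivative_transform_within_open[where S = "{0<..<1}"])
        show "complex_of_real ((x + s * (y - x)) powr \<alpha>) = cpow (p + of_real s * (q - p)) \<alpha>"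
          if "s \<in> {0<..<1}" for s
          using that eq[of s] by simp
      qed (use t in auto)
    qed
    with C show ?thesis by blast
  qed
  then show ?C "0 < t \<Longrightarrow> t < 1 \<Longrightarrow> ?D t" by blast+
qed

definition nonneg_entries :: "'i set \<Rightarrow> ('i \<Rightarrow> 'i \<Rightarrow> complex) \<Rightarrow> bool" where
  "nonneg_entries I a \<longleftrightarrow> (\<forall>i\<in>I. \<forall>k\<in>I. a i k \<in> \<real>\<^sub>\<ge>\<^sub>0)"

lemma nonneg_entries_rank_one:
  assumes "\<And>i. i \<in> I \<Longrightarrow> u i \<in> \<real>\<^sub>\<ge>\<^sub>0"
  shows "nonneg_entries I (\<lambda>i k. u i * cnj (u k))"
  unfolding nonneg_entries_def
proof (intro ballI)
  fix i k assume "i \<in> I" "k \<in> I"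
  then obtain s t where "u i = of_real s" "u k = of_real t" "0 \<le> s" "0 \<le> t"
    using assms by (metis nonneg_Reals_cases)
  then show "u i * cnj (u k) \<in> \<real>\<^sub>\<ge>\<^sub>0" by (simp flip: of_real_mult)
qed

lemma nonneg_entries_peel:
  assumes "finite I" "psd_on I a" "nonneg_entries I a" "p \<in> I" "i \<in> I"
  shows "a i p / of_real (sqrt (Re (a p p))) \<in> \<real>\<^sub>\<ge>\<^sub>0"
  using assms(3-5) psd_on_diag(1)[OF assms(2,4,1)]
  unfolding nonneg_entries_def by (intro nonneg_Reals_divide_I) auto

lemma nonneg_entries_segment:
  assumes "nonneg_entries I a" "nonneg_entries I b" "0 \<le> t" "t \<le> 1"
  shows "nonneg_entries I (\<lambda>i k. b i k + of_real t * (a i k - b i k))"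
  unfolding nonneg_entries_def
proof (intro ballI)
  fix i k assume "i \<in> I" "k \<in> I"
  then obtain x y where "a i k = of_real x" "b i k = of_real y" "0 \<le> x" "0 \<le> y"
    using assms(1,2) unfolding nonneg_entries_def by (metis nonneg_Reals_cases)
  moreover have "0 \<le> (1 - t) * y + t * x" using assms calculation by simp
  moreover have "b i k + of_real t * (a i k - b i k) = of_real ((1 - t) * y + t * x)"
    using calculation by (simp add: algebra_simps)
  ultimately show "b i k + of_real t * (a i k - b i k) \<in> \<real>\<^sub>\<ge>\<^sub>0" by (simp only: nonneg_Reals_of_real_iff)
qed

lemma psd_on_segment:
  assumes "psd_on I a" "psd_on I b" "0 \<le> t" "t \<le> 1"
  shows "psd_on I (\<lambda>i k. b i k + of_real t * (a i k - b i k))"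
proof -
  have "psd_on I (\<lambda>i k. of_real (1 - t) * b i k + of_real t * a i k)"
    using assms by (intro psd_on_add psd_on_scale) auto
  moreover have "of_real (1 - t) * b i k + of_real t * a i k = b i k + of_real t * (a i k - b i k)" for i k
    by (simp add: algebra_simps)
  ultimately show ?thesis by (simp only:)
qed

lemma herm_on_cpow:
  assumes "herm_on I a" "\<alpha> \<in> \<nat> \<or> nonneg_entries I a"
  shows "herm_on I (\<lambda>i k. cpow (a i k) \<alpha>)"
  using assms unfolding herm_on_def nonneg_entries_def by (metis cpow_cnj)

lemma psd_on_cpow_nat:
  assumes "finite I" "psd_on I a" "\<alpha> \<in> \<nat>"
  shows "psd_on I (\<lambda>i k. cpow (a i k) \<alpha>)"
proof -
  obtain m where m: "\<alpha> = real m" using assms(3) by (auto elim: Nats_cases)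
  have "psd_on I (\<lambda>i k. a i k ^ m)"
  proof (induction m)
    case 0
    show ?case using psd_on_rank_one[of I "\<lambda>_. 1"] by simp
  next
    case (Suc m)
    show ?case using psd_on_schur[OF assms(1,2) Suc.IH] by simp
  qed
  then show ?thesis by (simp add: m cpow_nat)
qed

text \<open>The powers with exponent \<open>\<alpha> - 1\<close> along the segment are assumed to be semidefinite, because they are known
  by induction in the proof of \<open>psd_on_cpow\<close> and by that theorem in the proof of \<open>psd_on_cpow_mono\<close>.\<close>

lemma psd_on_cpow_mono_step:
  assumes "finite I" "psd_on I a" "psd_on I b" "psd_on I (\<lambda>i k. a i k - b i k)"
    and ent: "\<alpha> \<in> \<nat> \<or> 0 \<le> \<alpha> \<and> nonneg_entries I a \<and> nonneg_entries I b"
    and deriv: "\<And>t. 0 < t \<Longrightarrow> t < 1 \<Longrightarrow> \<alpha> \<notin> \<nat> \<Longrightarrow>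
      psd_on I (\<lambda>i k. cpow (b i k + of_real t * (a i k - b i k)) (\<alpha> - 1))"
  shows "psd_on I (\<lambda>i k. cpow (a i k) \<alpha> - cpow (b i k) \<alpha>)"
proof (rule psd_on_mono_by_derivative[where f' = "\<lambda>z. of_real \<alpha> * cpow z (\<alpha> - 1)", OF assms(1,4)])
  show "herm_on I (\<lambda>i k. cpow (a i k) \<alpha>)" "herm_on I (\<lambda>i k. cpow (b i k) \<alpha>)"
    using assms by (auto intro!: herm_on_cpow simp: psd_on_def)
  fix i k assume ik: "i \<in> I" "k \<in> I"
  have *: "\<alpha> \<in> \<nat> \<or> 0 \<le> \<alpha> \<and> b i k \<in> \<real>\<^sub>\<ge>\<^sub>0 \<and> a i k \<in> \<real>\<^sub>\<ge>\<^sub>0"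
    using ent ik by (auto simp: nonneg_entries_def)
  show "continuous_on {0..1} (\<lambda>t. cpow (b i k + of_real t * (a i k - b i k)) \<alpha>)"
    by (rule cpow_segment(1)[OF *])
  show "((\<lambda>t. cpow (b i k + of_real t * (a i k - b i k)) \<alpha>) has_vector_derivative
      (a i k - b i k) * (of_real \<alpha> * cpow (b i k + of_real t * (a i k - b i k)) (\<alpha> - 1))) (at t)"
    if "0 < t" "t < 1" for t
    by (rule cpow_segment(2)[OF * that])
next
  fix t :: real assume t: "0 < t" "t < 1"
  show "psd_on I (\<lambda>i k. of_real \<alpha> * cpow (b i k + of_real t * (a i k - b i k)) (\<alpha> - 1))"
  proof (cases "\<alpha> \<in> \<nat>")
    case True
    then obtain m where m: "\<alpha> = real m" by (auto elim: Nats_cases)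
    show ?thesis
    proof (cases m)
      case 0
      then show ?thesis using psd_on_zero[of I] by (simp add: m)
    next
      case (Suc l)
      have "psd_on I (\<lambda>i k. cpow (b i k + of_real t * (a i k - b i k)) (real l))"
        using t by (intro psd_on_cpow_nat assms psd_on_segment) auto
      from psd_on_scale[OF _ this, of \<alpha>] show ?thesis using m Suc by simp
    qed
  next
    case False
    then show ?thesis using psd_on_scale[OF _ deriv[OF t False]] ent by auto
  qed
qed

text \<open>The theorem of FitzGerald and Horn. Peel \<open>a\<close> into a rank one matrix \<open>b\<close> and a matrix without
  row \<open>p\<close>: powers of \<open>b\<close> are again of rank one, and the difference of the powers of \<open>a\<close> and \<open>b\<close> lives on
  one row less, where the exponent \<open>\<alpha> - 1\<close> still satisfies the bound.\<close>

lemma psd_on_cpow: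
  assumes "finite I" "psd_on I a"
    and "\<alpha> \<in> \<nat> \<or> nonneg_entries I a \<and> real (card I) - 2 \<le> \<alpha>"
  shows "psd_on I (\<lambda>i k. cpow (a i k) \<alpha>)"
  using assms
proof (induction I arbitrary: a \<alpha> rule: finite_induct)
  case empty
  show ?case by (rule psd_on_empty)
next
  case (insert p I)
  show ?case
  proof (cases "\<alpha> \<in> \<nat>")
    case True
    then show ?thesis using insert.hyps insert.prems by (intro psd_on_cpow_nat) auto
  next
    case False
    then have nn: "nonneg_entries (insert p I) a" and \<alpha>: "real (card (insert p I)) - 2 \<le> \<alpha>"
      using insert.prems by auto
    define u where "u i = a i p / of_real (sqrt (Re (a p p)))" for i
    define b where "b i k = u i * cnj (u k)" for i k
    have fin: "finite (insert p I)" and pin: "p \<in> insert p I" using insert.hyps(1) by simp_all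
    note peel = psd_on_peel[OF fin insert.prems(1) pin u_def, folded b_def]
    have un: "u i \<in> \<real>\<^sub>\<ge>\<^sub>0" if "i \<in> insert p I" for i
      unfolding u_def by (rule nonneg_entries_peel[OF fin insert.prems(1) nn pin that])
    have bn: "nonneg_entries (insert p I) b"
      unfolding b_def[abs_def] using un by (rule nonneg_entries_rank_one)
    have "cpow (b i k) \<alpha> = cpow (u i) \<alpha> * cnj (cpow (u k) \<alpha>)"
      if "i \<in> insert p I" "k \<in> insert p I" for i k
      unfolding b_def using un that by (intro cpow_rank_one) blast
    then have 1: "psd_on (insert p I) (\<lambda>i k. cpow (b i k) \<alpha>)"
      using psd_on_rank_one by (subst psd_on_cong) auto
    have diff: "psd_on I (\<lambda>i k. cpow (a i k) \<alpha> - cpow (b i k) \<alpha>)"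
    proof (cases "I = {}")
      case True
      then show ?thesis by (simp add: psd_on_empty)
    next
      case False
      then have c: "card I \<ge> 1" using insert.hyps by (simp add: Suc_le_eq card_gt_0_iff)
      have sub: "psd_on I c" if "psd_on (insert p I) c" for c
        using psd_on_subset[OF that subset_insertI fin] .
      have nnI: "nonneg_entries I a" "nonneg_entries I b"
        using nn bn by (auto simp: nonneg_entries_def)
      have bpsd: "psd_on I b" unfolding b_def by (rule psd_on_rank_one)
      show ?thesis
      proof (rule psd_on_cpow_mono_step[OF insert.hyps(1) sub[OF insert.prems(1)] bpsd sub[OF peel(1)]])
        show "\<alpha> \<in> \<nat> \<or> 0 \<le> \<alpha> \<and> nonneg_entries I a \<and> nonneg_entries I b"
          using nnI \<alpha> c insert.hyps by simp
        fix t :: real assume t: "0 < t" "t < 1"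
        show "psd_on I (\<lambda>i k. cpow (b i k + of_real t * (a i k - b i k)) (\<alpha> - 1))"
        proof (rule insert.IH)
          show "psd_on I (\<lambda>i k. b i k + of_real t * (a i k - b i k))"
            using t by (intro psd_on_segment[OF sub[OF insert.prems(1)] bpsd]) auto
          show "\<alpha> - 1 \<in> \<nat> \<or> nonneg_entries I (\<lambda>i k. b i k + of_real t * (a i k - b i k)) \<and> real (card I) - 2 \<le> \<alpha> - 1"
            using nonneg_entries_segment[OF nnI, of t] t \<alpha> insert.hyps by simp
        qed
      qed
    qed
    have 2: "psd_on (insert p I) (\<lambda>i k. cpow (a i k) \<alpha> - cpow (b i k) \<alpha>)"
    proof (rule psd_on_extend_zero[OF _ fin, where p = p])
      have "insert p I - {p} = I" using insert.hyps by simp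
      with diff show "psd_on (insert p I - {p}) (\<lambda>i k. cpow (a i k) \<alpha> - cpow (b i k) \<alpha>)" by (simp only:)
      show "cpow (a i p) \<alpha> - cpow (b i p) \<alpha> = 0 \<and> cpow (a p i) \<alpha> - cpow (b p i) \<alpha> = 0"
        if "i \<in> insert p I" for i
        unfolding peel(2)[OF that] peel(3)[OF that] by simp
    qed
    have "cpow (b i k) \<alpha> + (cpow (a i k) \<alpha> - cpow (b i k) \<alpha>) = cpow (a i k) \<alpha>" for i k by simp
    then show ?thesis using psd_on_add[OF 1 2] by (simp only:)
  qed
qed

lemma psd_on_cpow_mono:
  assumes "finite I" "psd_on I a" "psd_on I b" "psd_on I (\<lambda>i k. a i k - b i k)"
    and "\<alpha> \<in> \<nat> \<or> 0 \<le> \<alpha> \<and> nonneg_entries I a \<and> nonneg_entries I b \<and> real (card I) - 1 \<le> \<alpha>"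
  shows "psd_on I (\<lambda>i k. cpow (a i k) \<alpha> - cpow (b i k) \<alpha>)"
proof (rule psd_on_cpow_mono_step[OF assms(1-4)])
  show "\<alpha> \<in> \<nat> \<or> 0 \<le> \<alpha> \<and> nonneg_entries I a \<and> nonneg_entries I b" using assms(5) by auto
  fix t :: real assume t: "0 < t" "t < 1" "\<alpha> \<notin> \<nat>"
  show "psd_on I (\<lambda>i k. cpow (b i k + of_real t * (a i k - b i k)) (\<alpha> - 1))"
    using t assms(5) by (intro psd_on_cpow[OF assms(1)] psd_on_segment assms(2,3))
      (auto intro!: nonneg_entries_segment)
qed

section \<open>Interpolation of a real power by real powers\<close>

text \<open>For \<open>M\<close> above all \<open>n k\<close>, the absolute value at \<open>M\<close> of the Lagrange basis polynomial for \<open>n j\<close>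
  among the nodes \<open>n k\<close>. These are the absolute values of the coefficients in the interpolation of \<open>t\<^bsup>M\<^esup>\<close> by the \<open>t\<^bsup>n k\<^esup>\<close> when
  all nodes coincide at \<open>1\<close>.\<close>

definition lagrange_abs :: "'k set \<Rightarrow> ('k \<Rightarrow> real) \<Rightarrow> real \<Rightarrow> 'k \<Rightarrow> real" where
  "lagrange_abs K n M j = (\<Prod>k\<in>K - {j}. (M - n k) / \<bar>n j - n k\<bar>)"

lemma lagrange_abs_nonneg: "(\<And>j. j \<in> K \<Longrightarrow> n j < M) \<Longrightarrow> 0 \<le> lagrange_abs K n M j"
  unfolding lagrange_abs_def by (intro prod_nonneg) (auto intro!: divide_nonneg_nonneg simp: less_imp_le)

lemma lagrange_abs_remove:
  assumes "finite K" "k \<in> K" "k \<noteq> j"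
  shows "lagrange_abs K n M j = (M - n k) / \<bar>n j - n k\<bar> * lagrange_abs (K - {k}) n M j"
proof -
  have "K - {j} = insert k (K - {k} - {j})" using assms by auto
  then show ?thesis using assms(1) unfolding lagrange_abs_def by simp
qed

lemma rolle_zeros:
  fixes g g' :: "real \<Rightarrow> real"
  assumes deriv: "\<And>t. t > 0 \<Longrightarrow> (g has_real_derivative g' t) (at t)"
    and "finite Z" "Z \<noteq> {}" "Z \<subseteq> {0<..}" "\<And>z. z \<in> Z \<Longrightarrow> g z = 0"
  obtains Z' where "finite Z'" "Suc (card Z') = card Z" "Z' \<subseteq> {0<..<Max Z}" "\<And>z. z \<in> Z' \<Longrightarrow> g' z = 0"
proof -
  have "\<exists>Z'. finite Z' \<and> Suc (card Z') = card Z \<and> Z' \<subseteq> {0<..<Max Z} \<and> (\<forall>z\<in>Z'. g' z = 0)"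
    using assms(2-)
  proof (induction Z rule: finite_linorder_max_induct)
    case empty
    then show ?case by simp
  next
    case (insert b Z)
    show ?case
    proof (cases "Z = {}")
      case True
      then show ?thesis by (intro exI[of _ "{}"]) auto
    next
      case False
      then obtain Z' where Z': "finite Z'" "Suc (card Z') = card Z" "Z' \<subseteq> {0<..<Max Z}" "\<forall>z\<in>Z'. g' z = 0"
        using insert.IH insert.prems by (metis insertCI insert_subset)
      define m where "m = Max Z"
      have "m \<in> Z" unfolding m_def using insert.hyps(1) False by (rule Max_in)
      then have m: "m \<in> Z" "m < b" "m > 0" using insert.hyps insert.prems by auto
      have b: "b \<notin> Z" using insert.hyps(2) by blast
      obtain z where z: "m < z" "z < b" "g' z = 0"
      proof -
        have "\<exists>z>m. z < b \<and> (g has_real_derivative 0) (at z)"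
        proof (rule Rolle)
          show "continuous_on {m..b} g"
            using m by (intro DERIV_continuous_on[where D = g']) (auto intro!: has_field_derivative_at_within deriv)
          show "g m = g b" using insert.prems m by simp
          show "\<And>x. m < x \<Longrightarrow> x < b \<Longrightarrow> g differentiable (at x)"
            using m deriv by (meson order.strict_trans real_differentiable_def)
        qed (use m in auto)
        then obtain z where "m < z" "z < b" "(g has_real_derivative 0) (at z)" by blast
        moreover have "(g has_real_derivative g' z) (at z)" using calculation m deriv by simp
        ultimately show ?thesis using that DERIV_unique by blast
      qed
      have "Max (insert b Z) = b" using insert.hyps by (intro Max_eqI) (auto intro: less_imp_le)
      moreover have "z \<notin> Z'" using Z'(3) z m_def by auto
      ultimately show ?thesis
        using Z' z m b insert.hyps(1) m_def
        by (intro exI[of _ "insert z Z'"]) (auto dest!: subsetD[of Z'])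
    qed
  qed
  then show ?thesis using that by blast
qed

lemma powr_sum_deriv:
  assumes "t > 0"
  shows "((\<lambda>t. \<Sum>j\<in>K. x j * t powr e j) has_real_derivative (\<Sum>j\<in>K. (x j * e j) * t powr (e j - 1))) (at t)"
  using assms by (auto intro!: derivative_eq_intros sum.cong)

text \<open>Dividing by \<open>t\<^bsup>n k\<^esup>\<close> makes one summand constant, and differentiation removes it at
  the price of one zero.\<close>

lemma powr_sum_unique:
  fixes x n :: "'k \<Rightarrow> real"
  assumes "finite K" "inj_on n K" "finite Z" "Z \<subseteq> {0<..}" "card K \<le> card Z"
    and "\<And>z. z \<in> Z \<Longrightarrow> (\<Sum>j\<in>K. x j * z powr n j) = 0" "j \<in> K"
  shows "x j = 0"
  using assms
proof (induction K arbitrary: x n Z j rule: finite_induct)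
  case empty
  then show ?case by simp
next
  case (insert k K)
  have "Z \<noteq> {}" using insert.prems insert.hyps by auto
  have eq: "z powr (- n k) * (\<Sum>j\<in>insert k K. x j * z powr n j) = (\<Sum>j\<in>insert k K. x j * z powr (n j - n k))" for z
    by (simp only: sum_distrib_left) (intro sum.cong refl, simp add: powr_add[symmetric] mult.assoc mult.left_commute)
  obtain Z' where Z': "finite Z'" "Suc (card Z') = card Z" "Z' \<subseteq> {0<..<Max Z}"
    "\<And>z. z \<in> Z' \<Longrightarrow> (\<Sum>j\<in>insert k K. (x j * (n j - n k)) * z powr (n j - n k - 1)) = 0"
  proof (rule rolle_zeros[OF powr_sum_deriv insert.prems(2) \<open>Z \<noteq> {}\<close> insert.prems(3)])
    show "(\<Sum>j\<in>insert k K. x j * z powr (n j - n k)) = 0" if "z \<in> Z" for z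
      using insert.prems(5)[OF that] eq[of z] by simp
  qed auto
  have rest: "x i = 0" if "i \<in> K" for i
  proof -
    have "x i * (n i - n k) = 0"
    proof (rule insert.IH[where x = "\<lambda>i. x i * (n i - n k)" and n = "\<lambda>i. n i - n k - 1" and Z = Z'])
      show "inj_on (\<lambda>i. n i - n k - 1) K" using insert.prems(1) by (auto simp: inj_on_def)
      show "card K \<le> card Z'" using insert.prems(4) insert.hyps Z'(2) by simp
      show "(\<Sum>j\<in>K. (x j * (n j - n k)) * z powr (n j - n k - 1)) = 0" if "z \<in> Z'" for z
        using Z'(4)[OF that] insert.hyps by simp
    qed (use Z' that in auto)
    moreover have "n i \<noteq> n k" using insert.prems(1) insert.hyps that by (auto simp: inj_on_def)
    ultimately show ?thesis by simp
  qed
  obtain z where z: "z \<in> Z" using \<open>Z \<noteq> {}\<close> by auto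
  have "x k * z powr n k = 0"
    using insert.prems(5)[OF z] insert.hyps rest by simp
  then show ?case using insert.prems(3,6) z rest by auto
qed

text \<open>The error \<open>t\<^bsup>M\<^esup> - \<Sum>j\<in>K. x j t\<^bsup>n j\<^esup>\<close> vanishes on \<open>Z\<close>. After division by \<open>t\<^bsup>n k\<^esup>\<close> for some \<open>k \<noteq> j\<close>,
  Rolle's theorem yields an interpolation of the same kind without \<open>k\<close>, in which the \<open>j\<close>-th coefficient
  is \<open>x j\<close> times \<open>(n j - n k) / (M - n k)\<close>. Iteration leaves \<open>j\<close> alone, where \<open>x j\<close> is a power of the
  single node.\<close>

lemma powr_interpolation_bound:
  fixes x n :: "'k \<Rightarrow> real"
  assumes "finite K" "inj_on n K" "finite Z" "Z \<subseteq> {0<..r}" "card Z = card K"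
    and "\<And>j. j \<in> K \<Longrightarrow> n j < M"
    and "\<And>z. z \<in> Z \<Longrightarrow> z powr M = (\<Sum>j\<in>K. x j * z powr n j)" "j \<in> K"
  shows "\<bar>x j\<bar> \<le> lagrange_abs K n M j * r powr (M - n j)"
  using assms
proof (induction "card K" arbitrary: K x n M Z)
  case 0
  then show ?case by auto
next
  case (Suc m)
  show ?case
  proof (cases "K = {j}")
    case True
    then obtain z where z: "z \<in> Z" using Suc.prems by (metis card.empty ex_in_conv finite.emptyI card_1_singleton_iff is_singletonI is_singleton_altdef n_not_Suc_n One_nat_def)
    then have "z powr M = x j * z powr n j" "0 < z" "z \<le> r" using Suc.prems True by auto
    then have "x j = z powr (M - n j)" by (simp add: powr_diff field_simps)
    moreover have "z powr (M - n j) \<le> r powr (M - n j)"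
      using \<open>0 < z\<close> \<open>z \<le> r\<close> Suc.prems by (intro powr_mono2) (auto simp: less_imp_le)
    ultimately show ?thesis by (simp add: lagrange_abs_def True)
  next
    case False
    then obtain k where k: "k \<in> K" "k \<noteq> j" using Suc.prems by auto
    have "Z \<noteq> {}" using Suc.prems Suc.hyps(2) by auto
    have Mk: "M - n k > 0" using Suc.prems k by simp
    define K' where "K' = K - {k}"
    have K': "finite K'" "K = insert k K'" "k \<notin> K'" "j \<in> K'" "card K' = m"
      using k Suc.prems(1,8) Suc.hyps(2) by (auto simp: K'_def)
    define g where "g t = t powr (M - n k) - (\<Sum>i\<in>K. x i * t powr (n i - n k))" for t
    define g' where "g' t = (M - n k) * t powr (M - n k - 1) - (\<Sum>i\<in>K. (x i * (n i - n k)) * t powr (n i - n k - 1))" for t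
    have d: "(g has_real_derivative g' t) (at t)" if "t > 0" for t
      unfolding g_def g'_def using that
      by (intro DERIV_diff powr_sum_deriv) (auto intro!: derivative_eq_intros)
    have g0: "g z = 0" if "z \<in> Z" for z
    proof -
      have "(\<Sum>i\<in>K. x i * z powr (n i - n k)) = z powr (- n k) * (\<Sum>i\<in>K. x i * z powr n i)"
        by (simp only: sum_distrib_left) (intro sum.cong refl, simp add: powr_add[symmetric] mult.assoc mult.left_commute)
      also have "\<dots> = z powr (M - n k)"
        unfolding Suc.prems(7)[OF that, symmetric] by (simp add: powr_add[symmetric])
      finally show ?thesis by (simp add: g_def)
    qed
    have "Z \<subseteq> {0<..}" using Suc.prems by auto
    obtain Z' where Z': "finite Z'" "Suc (card Z') = card Z" "Z' \<subseteq> {0<..<Max Z}" "\<And>z. z \<in> Z' \<Longrightarrow> g' z = 0"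
      using rolle_zeros[OF d Suc.prems(3) \<open>Z \<noteq> {}\<close> \<open>Z \<subseteq> {0<..}\<close> g0] by blast
    have "Max Z \<le> r" using Suc.prems \<open>Z \<noteq> {}\<close> by auto
    define x' where "x' i = x i * (n i - n k) / (M - n k)" for i
    have "\<bar>x' j\<bar> \<le> lagrange_abs K' (\<lambda>i. n i - n k - 1) (M - n k - 1) j * r powr ((M - n k - 1) - (n j - n k - 1))"
    proof (rule Suc.hyps(1)[where Z = Z'])
      show "inj_on (\<lambda>i. n i - n k - 1) K'" using Suc.prems(2) K' by (auto simp: inj_on_def)
      show "card Z' = card K'" using Z'(2) K'(5) Suc.hyps(2) Suc.prems(5) by simp
      show "Z' \<subseteq> {0<..r}" using Z'(3) \<open>Max Z \<le> r\<close> by auto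
      show "z powr (M - n k - 1) = (\<Sum>i\<in>K'. x' i * z powr (n i - n k - 1))" if "z \<in> Z'" for z
      proof -
        have "(M - n k) * z powr (M - n k - 1) = (\<Sum>i\<in>K'. (x i * (n i - n k)) * z powr (n i - n k - 1))"
          using Z'(4)[OF that] K'(1,3) unfolding g'_def K'(2) by simp
        then show ?thesis using Mk by (simp add: x'_def field_simps flip: sum_divide_distrib)
      qed
    qed (use K'(1,4,5) Z'(1) Suc.prems(6) in \<open>auto simp: K'_def\<close>)
    moreover have "lagrange_abs K' (\<lambda>i. n i - n k - 1) (M - n k - 1) j = lagrange_abs K' n M j"
      by (simp add: lagrange_abs_def)
    ultimately have x': "\<bar>x' j\<bar> \<le> lagrange_abs K' n M j * r powr (M - n j)" by simp
    have nn: "n j \<noteq> n k" using Suc.prems(2,8) k by (auto simp: inj_on_def)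
    have "K - {j} = insert k (K' - {j})" using K' k by auto
    then have L: "lagrange_abs K n M j = (M - n k) / \<bar>n j - n k\<bar> * lagrange_abs K' n M j"
      using K' by (simp add: lagrange_abs_def)
    have "\<bar>x j\<bar> = (M - n k) / \<bar>n j - n k\<bar> * \<bar>x' j\<bar>"
      using Mk nn by (simp add: x'_def abs_mult)
    also have "\<dots> \<le> (M - n k) / \<bar>n j - n k\<bar> * (lagrange_abs K' n M j * r powr (M - n j))"
      using Mk x' by (intro mult_left_mono) auto
    finally show ?thesis by (simp add: L)
  qed
qed

text \<open>Newton interpolation: for \<open>k \<in> K\<close> and \<open>w \<in> U\<close>, subtracting from \<open>F \<cdot> k\<close> its interpolant on the other
  nodes gives a combination \<open>Z\<close> that vanishes at these nodes but, by uniqueness, not at \<open>w\<close>. A multiple of \<open>Z\<close> corrects an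
  interpolant on the other nodes.\<close>

lemma unisolvent_of_unique:
  fixes F :: "'u \<Rightarrow> 'k \<Rightarrow> 'a::field"
  assumes "finite K" "finite U" "card K = card U"
    and "\<And>K' U' x j. K' \<subseteq> K \<Longrightarrow> U' \<subseteq> U \<Longrightarrow> card K' = card U' \<Longrightarrow>
      (\<And>u. u \<in> U' \<Longrightarrow> (\<Sum>j\<in>K'. x j * F u j) = 0) \<Longrightarrow> j \<in> K' \<Longrightarrow> x j = 0"
  shows "\<exists>x. \<forall>u\<in>U. (\<Sum>j\<in>K. x j * F u j) = h u"
  using assms
proof (induction "card K" arbitrary: K U h)
  case 0
  then show ?case by auto
next
  case (Suc m)
  obtain k w where kw: "k \<in> K" "w \<in> U"
    using Suc.hyps(2) Suc.prems(1-3) by (metis card.empty ex_in_conv nat.distinct(1))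
  define K' U' where "K' = K - {k}" and "U' = U - {w}"
  have K': "finite K'" "K = insert k K'" "k \<notin> K'" "K' \<subseteq> K" "card K' = m"
    using kw Suc.hyps(2) Suc.prems(1) by (auto simp: K'_def)
  have U': "finite U'" "U = insert w U'" "w \<notin> U'" "U' \<subseteq> U" "card U' = m"
    using kw Suc.hyps(2) Suc.prems(2,3) by (auto simp: U'_def)
  have ex: "\<exists>x. \<forall>u\<in>U'. (\<Sum>j\<in>K'. x j * F u j) = g u" for g
  proof (rule Suc.hyps(1))
    show "m = card K'" "finite K'" "finite U'" "card K' = card U'" using K' U' by simp_all
    show "x j = 0" if "K'' \<subseteq> K'" "U'' \<subseteq> U'" "card K'' = card U''"
      "\<And>u. u \<in> U'' \<Longrightarrow> (\<Sum>j\<in>K''. x j * F u j) = 0" "j \<in> K''" for K'' U'' x j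
      using Suc.prems(4)[of K'' U'' x j] that K'(4) U'(4) by blast
  qed
  obtain y where y: "\<And>u. u \<in> U' \<Longrightarrow> (\<Sum>j\<in>K'. y j * F u j) = F u k" using ex[of "\<lambda>u. F u k"] by blast
  obtain p where p: "\<And>u. u \<in> U' \<Longrightarrow> (\<Sum>j\<in>K'. p j * F u j) = h u" using ex[of h] by blast
  define Z where "Z u = F u k - (\<Sum>j\<in>K'. y j * F u j)" for u
  define z where "z j = (if j = k then 1 else - y j)" for j
  have Zz: "(\<Sum>j\<in>K. z j * F u j) = Z u" for u
  proof -
    have "(\<Sum>j\<in>K'. z j * F u j) = (\<Sum>j\<in>K'. - (y j * F u j))"
      using K'(3) by (intro sum.cong) (auto simp: z_def)
    then show ?thesis using K'(1,3) unfolding K'(2) by (simp add: Z_def z_def sum_negf)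
  qed
  have "Z w \<noteq> 0"
  proof
    assume "Z w = 0"
    then have "(\<Sum>j\<in>K. z j * F u j) = 0" if "u \<in> U" for u
      using that y unfolding Zz U'(2) by (auto simp: Z_def)
    then have "z k = 0" using Suc.prems(3,4) kw(1) by blast
    then show False by (simp add: z_def)
  qed
  \<comment> \<open>the multiple of \<open>Z\<close> that repairs the value at \<open>w\<close>\<close>
  define t where "t = (h w - (\<Sum>j\<in>K'. p j * F w j)) / Z w"
  have "(\<Sum>j\<in>K. ((if j = k then 0 else p j) + t * z j) * F u j) = (\<Sum>j\<in>K'. p j * F u j) + t * Z u" for u
  proof -
    have "(\<Sum>j\<in>K. ((if j = k then 0 else p j) + t * z j) * F u j)
        = (\<Sum>j\<in>K. (if j = k then 0 else p j) * F u j) + t * (\<Sum>j\<in>K. z j * F u j)"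
      by (simp add: distrib_right sum.distrib sum_distrib_left mult.assoc)
    also have "(\<Sum>j\<in>K. (if j = k then 0 else p j) * F u j) = (\<Sum>j\<in>K'. p j * F u j)"
      using K'(1,3) unfolding K'(2) by (auto intro!: sum.cong)
    finally show ?thesis by (simp add: Zz)
  qed
  moreover have "(\<Sum>j\<in>K'. p j * F u j) + t * Z u = h u" if "u \<in> U" for u
    using that p y \<open>Z w \<noteq> 0\<close> unfolding U'(2) by (auto simp: t_def) (simp add: Z_def)
  ultimately have "\<forall>u\<in>U. (\<Sum>j\<in>K. ((if j = k then 0 else p j) + t * z j) * F u j) = h u" by simp
  then show ?case by (rule exI[where P = "\<lambda>x. \<forall>u\<in>U. (\<Sum>j\<in>K. x j * F u j) = h u"])
qed

lemma powr_unisolvent: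
  fixes n :: "'k \<Rightarrow> real" and h :: "real \<Rightarrow> real"
  assumes "finite K" "inj_on n K" "finite U" "U \<subseteq> {0<..}" "card K = card U"
  shows "\<exists>x. \<forall>u\<in>U. (\<Sum>j\<in>K. x j * u powr n j) = h u"
proof (rule unisolvent_of_unique[where F = "\<lambda>u j. u powr n j", OF assms(1,3,5)])
  fix K' U' x j
  assume *: "K' \<subseteq> K" "U' \<subseteq> U" "card K' = card U'" "j \<in> K'"
    and zero: "\<And>u. u \<in> U' \<Longrightarrow> (\<Sum>j\<in>K'. x j * u powr n j) = 0"
  show "x j = 0"
  proof (rule powr_sum_unique[where K = K' and n = n and Z = U'])
    show "finite K'" "finite U'" using * assms finite_subset by blast+
    show "inj_on n K'" using *(1) assms(2) by (rule inj_on_subset[rotated])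
  qed (use * assms zero in auto)
qed

text \<open>Fewer nodes than exponents are padded by further nodes in the same interval, so that the
  sharp bound applies.\<close>

lemma powr_interpolation:
  fixes n :: "'k \<Rightarrow> real"
  assumes "finite K" "inj_on n K" "\<And>j. j \<in> K \<Longrightarrow> n j < M" "0 < r"
    and "finite U" "U \<subseteq> {0<..r}" "card U \<le> card K"
  shows "\<exists>x. (\<forall>u\<in>U. u powr M = (\<Sum>j\<in>K. x j * u powr n j)) \<and>
    (\<forall>j\<in>K. \<bar>x j\<bar> \<le> lagrange_abs K n M j * r powr (M - n j))"
proof -
  have "infinite ({0<..r} - U)" using assms(4,5) by simp
  then obtain T where T: "finite T" "card T = card K - card U" "T \<subseteq> {0<..r} - U"
    using infinite_arbitrarily_large by blast
  define Z where "Z = U \<union> T"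
  have Z: "finite Z" "card Z = card K" "Z \<subseteq> {0<..r}" "U \<subseteq> Z"
    using T assms(5-7) card_Un_disjoint[of U T] by (auto simp: Z_def)
  have "Z \<subseteq> {0<..}" using Z(3) by auto
  from powr_unisolvent[OF assms(1,2) Z(1) this, of "\<lambda>u. u powr M"]
  obtain x where "\<forall>u\<in>Z. (\<Sum>j\<in>K. x j * u powr n j) = u powr M"
    using Z(2) by auto
  then have x: "\<And>u. u \<in> Z \<Longrightarrow> u powr M = (\<Sum>j\<in>K. x j * u powr n j)" by simp
  then show ?thesis
    using powr_interpolation_bound[OF assms(1,2) Z(1,3,2) assms(3), where x = x] Z(4) by blast
qed

text \<open>A node at \<open>0\<close> is delicate only if some exponent \<open>n k\<close> is \<open>0\<close>. Then the coefficient of \<open>k\<close> has to be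
  \<open>0\<close>, and the other nodes and exponents give an interpolation whose bound lacks the factor
  \<open>(M - n k) / |n j - n k| = M / n j > 1\<close>.\<close>

lemma nonneg_interpolation:
  assumes "finite K" "inj_on n K" "\<And>j. j \<in> K \<Longrightarrow> n j < M" "0 < r"
    and "finite U" "U \<subseteq> {0..r}" "card U \<le> card K"
    and nn: "0 \<in> U \<Longrightarrow> \<forall>j\<in>K. 0 \<le> n j"
  shows "\<exists>x. (\<forall>u\<in>U. cpow (of_real u) M = (\<Sum>j\<in>K. of_real (x j) * cpow (of_real u) (n j))) \<and>
    (\<forall>j\<in>K. \<bar>x j\<bar> \<le> lagrange_abs K n M j * r powr (M - n j))"
proof -
  define U' where "U' = U - {0}"
  have U': "finite U'" "U' \<subseteq> {0<..r}" "card U' \<le> card K" "U' \<subseteq> {0<..}"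
    using assms(5-7) card_Diff1_le[of U 0] by (auto simp: U'_def)
  have to_cpow: "cpow (of_real u) M = (\<Sum>j\<in>L. of_real (x j) * cpow (of_real u) (n j))"
    if "u powr M = (\<Sum>j\<in>L. x j * u powr n j)" "u \<in> U'" for u L x
    using that U'(4) by (auto simp: cpow_of_real subset_iff)
  show ?thesis
  proof (cases "0 \<in> U \<and> (\<exists>j\<in>K. n j = 0)")
    case False
    obtain x where x: "\<And>u. u \<in> U' \<Longrightarrow> u powr M = (\<Sum>j\<in>K. x j * u powr n j)"
      "\<forall>j\<in>K. \<bar>x j\<bar> \<le> lagrange_abs K n M j * r powr (M - n j)"
      using powr_interpolation[OF assms(1-4) U'(1-3)] by blast
    have "cpow (of_real u) M = (\<Sum>j\<in>K. of_real (x j) * cpow (of_real u) (n j))" if "u \<in> U" for u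
    proof (cases "u = 0")
      case True
      then have pos: "\<forall>j\<in>K. 0 < n j" using that False nn by (auto simp: order_less_le)
      have "card U > 0" using that assms(5) card_gt_0_iff by blast
      then obtain j where "j \<in> K" using assms(7) by fastforce
      then have "0 < M" using pos assms(3) by (meson order_less_trans)
      then show ?thesis using pos True by (simp add: cpow_zero)
    next
      case False
      then show ?thesis using that x(1) to_cpow by (simp add: U'_def)
    qed
    with x(2) show ?thesis by blast
  next
    case True
    then obtain k where k: "k \<in> K" "n k = 0" "0 \<in> U" by blast
    define K' where "K' = K - {k}"
    have pos: "0 < n j" if "j \<in> K'" for j
      using that k assms(2) nn by (auto simp: K'_def inj_on_def order_less_le)
    have card: "card U' \<le> card K'" using k assms(1,5,7) by (simp add: U'_def K'_def)
    obtain x where x: "\<And>u. u \<in> U' \<Longrightarrow> u powr M = (\<Sum>j\<in>K'. x j * u powr n j)"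
      "\<And>j. j \<in> K' \<Longrightarrow> \<bar>x j\<bar> \<le> lagrange_abs K' n M j * r powr (M - n j)"
      using powr_interpolation[of K' n M r U'] assms(1-4) U'(1,2) card
      by (auto simp: K'_def inj_on_diff)
    define y where "y j = (if j = k then 0 else x j)" for j
    have sum_y: "(\<Sum>j\<in>K. of_real (y j) * cpow (of_real u) (n j)) = (\<Sum>j\<in>K'. of_real (x j) * cpow (of_real u) (n j))" for u
      unfolding K'_def using assms(1) k(1)
      by (subst sum.remove[of K k]) (auto simp: y_def intro!: sum.cong)
    have "cpow (of_real u) M = (\<Sum>j\<in>K. of_real (y j) * cpow (of_real u) (n j))" if "u \<in> U" for u
    proof (cases "u = 0")
      case True
      then show ?thesis using pos k assms(3)[OF k(1)] unfolding sum_y by (simp add: cpow_zero)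
    next
      case False
      then show ?thesis using that x(1) to_cpow unfolding sum_y by (simp add: U'_def)
    qed
    moreover have "\<bar>y j\<bar> \<le> lagrange_abs K n M j * r powr (M - n j)" if "j \<in> K" for j
    proof (cases "j = k")
      case True
      then show ?thesis using lagrange_abs_nonneg[of K n M j] assms(3) by (simp add: y_def)
    next
      case False
      then have j: "j \<in> K'" using that by (simp add: K'_def)
      have "1 \<le> M / n j" using pos[OF j] assms(3)[OF that] by simp
      moreover have "0 \<le> lagrange_abs K' n M j * r powr (M - n j)"
        using lagrange_abs_nonneg[of K' n M j] assms(3) by (simp add: K'_def)
      ultimately have "1 * (lagrange_abs K' n M j * r powr (M - n j)) \<le> M / n j * (lagrange_abs K' n M j * r powr (M - n j))"
        by (rule mult_right_mono)
      then show ?thesis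
        using x(2)[OF j] False pos[OF j] lagrange_abs_remove[OF assms(1) k(1), of j n M] k(2)
        by (simp add: y_def K'_def)
    qed
    ultimately show ?thesis by blast
  qed
qed

text \<open>At the node \<open>0\<close> only the constant power is nonzero, so its coefficient is the value there.\<close>

lemma nonneg_unisolvent:
  assumes "finite K" "inj_on n K" "finite U" "U \<subseteq> {0..}" "card K = card U"
    and "0 \<in> U \<Longrightarrow> \<exists>j\<in>K. n j = 0"
  shows "\<exists>x. \<forall>u\<in>U. (\<Sum>j\<in>K. of_real (x j) * cpow (of_real u) (n j)) = of_real (h u)"
proof (cases "0 \<in> U")
  case False
  then have pos: "U \<subseteq> {0<..}" using assms(4) by (auto simp: order_less_le)
  obtain x where x: "\<forall>u\<in>U. (\<Sum>j\<in>K. x j * u powr n j) = h u"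
    using powr_unisolvent[OF assms(1-3) pos assms(5)] by blast
  have "(\<Sum>j\<in>K. of_real (x j) * cpow (of_real u) (n j)) = of_real (h u)" if "u \<in> U" for u
    using x pos that by (auto simp: cpow_of_real subset_iff simp flip: of_real_mult of_real_sum)
  then show ?thesis by blast
next
  case True
  then obtain k where k: "k \<in> K" "n k = 0" using assms(6) by blast
  define K' U' where "K' = K - {k}" and "U' = U - {0}"
  have "U' \<subseteq> {0<..}" using assms(4) by (auto simp: U'_def order_less_le)
  obtain x where x: "\<And>u. u \<in> U' \<Longrightarrow> (\<Sum>j\<in>K'. x j * u powr n j) = h u - h 0"
    using powr_unisolvent[of K' n U' "\<lambda>u. h u - h 0"] assms True k \<open>U' \<subseteq> {0<..}\<close>
    by (auto simp: K'_def U'_def inj_on_diff)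
  define y where "y j = (if j = k then h 0 else x j)" for j
  have sum_y: "(\<Sum>j\<in>K. of_real (y j) * cpow (of_real u) (n j))
      = of_real (h 0) + (\<Sum>j\<in>K'. of_real (x j) * cpow (of_real u) (n j))" for u
    unfolding K'_def using assms(1) k
    by (subst sum.remove[of K k]) (auto simp: y_def cpow_def intro!: sum.cong)
  have "(\<Sum>j\<in>K. of_real (y j) * cpow (of_real u) (n j)) = of_real (h u)" if "u \<in> U" for u
  proof (cases "u = 0")
    case True
    have "n j \<noteq> 0" if "j \<in> K'" for j using that k assms(2) by (auto simp: K'_def inj_on_def)
    then show ?thesis unfolding sum_y by (simp add: True cpow_def)
  next
    case False
    then have u: "u \<in> U'" "0 < u" using that \<open>U' \<subseteq> {0<..}\<close> by (auto simp: U'_def)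
    have "(\<Sum>j\<in>K'. complex_of_real (x j) * cpow (of_real u) (n j)) = of_real (h u - h 0)"
      using u by (simp add: cpow_of_real x[symmetric])
    then show ?thesis unfolding sum_y by simp
  qed
  then show ?thesis by blast
qed

section \<open>Interpolation of a power by consecutive powers in the complex plane\<close>

text \<open>The products of two binomial coefficients count the semistandard tableaux of hook shape;
  the identity is the branching rule for the removal of one variable.\<close>

lemma hook_tableaux_recursion:
  assumes "j \<le> N" "N \<le> m"
  shows "(m choose j) * ((m - 1 - j) choose (N - j))
      + (if j = 0 then 0 else (m choose (j - 1)) * ((m - j) choose (N - j)))
      + (if j < N then (m choose j) * ((m - 1 - j) choose (N - 1 - j)) else 0)
    = (Suc m choose j) * ((m - j) choose (N - j))"
proof -
  have pascal: "(m choose j) + (if j = 0 then 0 else m choose (j - 1)) = Suc m choose j"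
    by (cases j) auto
  have "((m - 1 - j) choose (N - j)) + (if j < N then (m - 1 - j) choose (N - 1 - j) else 0) = (m - j) choose (N - j)"
  proof (cases "j < N")
    case True
    then have "m - j = Suc (m - 1 - j)" "N - j = Suc (N - 1 - j)" using assms by auto
    then show ?thesis using True by simp
  next
    case False
    then show ?thesis using assms by simp
  qed
  then have "(m choose j) * (((m - 1 - j) choose (N - j)) + (if j < N then (m - 1 - j) choose (N - 1 - j) else 0))
      + (if j = 0 then 0 else m choose (j - 1)) * ((m - j) choose (N - j))
      = ((m choose j) + (if j = 0 then 0 else m choose (j - 1))) * ((m - j) choose (N - j))"
    by (simp add: algebra_simps)
  then show ?thesis unfolding pascal by (auto simp: algebra_simps split: if_splits)
qed

text \<open>Let \<open>x\<close> be the coefficients for the power \<open>m\<close> on \<open>U\<close>, and \<open>y\<close> those for the power \<open>m\<close> on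
  \<open>U - {u}\<close>. Then \<open>u \<Sum>j. x j w\<^sup>j + (w - u) \<Sum>j. y j w\<^sup>j\<close> interpolates \<open>w\<^bsup>m + 1\<^esup>\<close>. Estimating
  the three contributions to each coefficient separately loses nothing, since the binomial counts
  in the bound satisfy the same recursion.\<close>

lemma complex_power_interpolation:
  fixes U :: "complex set"
  assumes "0 \<le> r" "finite U" "U \<subseteq> cball 0 r" "card U \<le> N" "N \<le> Suc m"
  shows "\<exists>x. (\<forall>u\<in>U. u ^ m = (\<Sum>j<N. x j * u ^ j)) \<and>
    (\<forall>j<N. cmod (x j) \<le> real ((m choose j) * ((m - 1 - j) choose (N - 1 - j))) * r ^ (m - j))"
  using assms(2-)
proof (induction N arbitrary: U m)
  case 0
  then show ?case by simp
next
  case (Suc N)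
  show ?case
  proof (cases "U = {}")
    case True
    then show ?thesis using assms(1) by (intro exI[of _ "\<lambda>_. 0"]) simp
  next
    case False
    then obtain u where u: "u \<in> U" by blast
    define U' where "U' = U - {u}"
    have U': "finite U'" "U' \<subseteq> cball 0 r" "card U' \<le> N"
      using Suc.prems u by (auto simp: U'_def)
    have "N \<le> m" using Suc.prems by simp
    then show ?thesis
    proof (induction m rule: dec_induct)
      case base
      define x where "x j = (if j = N then 1 else 0 :: complex)" for j
      have "(\<Sum>j<Suc N. x j * w ^ j) = w ^ N" for w by (simp add: x_def)
      moreover have "cmod (x j) \<le> real ((N choose j) * ((N - 1 - j) choose (Suc N - 1 - j))) * r ^ (N - j)"
        for j using assms(1) by (simp add: x_def)
      ultimately show ?case by (intro exI[of _ x]) simp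
    next
      case (step m)
      obtain x where x: "\<And>w. w \<in> U \<Longrightarrow> w ^ m = (\<Sum>j<Suc N. x j * w ^ j)"
        and xb: "\<And>j. j < Suc N \<Longrightarrow>
          cmod (x j) \<le> real ((m choose j) * ((m - 1 - j) choose (N - j))) * r ^ (m - j)"
        using step.IH by auto
      obtain y where y: "\<And>w. w \<in> U' \<Longrightarrow> w ^ m = (\<Sum>j<N. y j * w ^ j)"
        and yb: "\<And>j. j < N \<Longrightarrow>
          cmod (y j) \<le> real ((m choose j) * ((m - 1 - j) choose (N - 1 - j))) * r ^ (m - j)"
        using Suc.IH[OF U', of m] step.hyps by auto
      define z where "z j = u * x j + (if j = 0 then 0 else y (j - 1)) - (if j < N then u * y j else 0)" for j
      have z: "(\<Sum>j<Suc N. z j * w ^ j) = u * (\<Sum>j<Suc N. x j * w ^ j) + (w - u) * (\<Sum>j<N. y j * w ^ j)" for w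
      proof -
        have "(\<Sum>j<Suc N. (if j = 0 then 0 else y (j - 1)) * w ^ j) = w * (\<Sum>j<N. y j * w ^ j)"
          by (simp only: sum.lessThan_Suc_shift) (simp add: sum_distrib_left algebra_simps)
        moreover have "(\<Sum>j<Suc N. (if j < N then u * y j else 0) * w ^ j) = u * (\<Sum>j<N. y j * w ^ j)"
          by (simp add: sum_distrib_left algebra_simps)
        moreover have "(\<Sum>j<Suc N. z j * w ^ j) = u * (\<Sum>j<Suc N. x j * w ^ j)
            + (\<Sum>j<Suc N. (if j = 0 then 0 else y (j - 1)) * w ^ j)
            - (\<Sum>j<Suc N. (if j < N then u * y j else 0) * w ^ j)"
          unfolding z_def sum_distrib_left sum.distrib[symmetric] sum_subtractf[symmetric]
          by (intro sum.cong refl) (simp add: algebra_simps)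
        ultimately show ?thesis by (simp add: algebra_simps)
      qed
      have "w ^ Suc m = (\<Sum>j<Suc N. z j * w ^ j)" if "w \<in> U" for w
      proof (cases "w = u")
        case True
        then show ?thesis unfolding z using x[OF that] by simp
      next
        case False
        then have "w \<in> U'" using that by (simp add: U'_def)
        then show ?thesis unfolding z using x[OF that] y by (simp add: algebra_simps)
      qed
      moreover have "cmod (z j) \<le> real ((Suc m choose j) * ((m - j) choose (N - j))) * r ^ (Suc m - j)"
        if "j < Suc N" for j
      proof -
        have ur: "cmod u \<le> r" using u Suc.prems(2) by auto
        have pw: "r * r ^ (m - j) = r ^ (Suc m - j)" using that step.hyps by (simp add: Suc_diff_le)
        have "cmod (z j) \<le> cmod (u * x j) + cmod (if j = 0 then 0 else y (j - 1)) + cmod (if j < N then u * y j else 0)"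
          unfolding z_def by (meson norm_triangle_ineq norm_triangle_ineq4 order_trans add_right_mono)
        moreover have "cmod (u * x j) \<le> real ((m choose j) * ((m - 1 - j) choose (N - j))) * r ^ (Suc m - j)"
          using mult_mono[OF ur xb[OF that]] assms(1) unfolding norm_mult pw[symmetric] by (simp add: mult_ac)
        moreover have "cmod (if j = 0 then 0 else y (j - 1))
            \<le> real (if j = 0 then 0 else (m choose (j - 1)) * ((m - j) choose (N - j))) * r ^ (Suc m - j)"
          using yb[of "j - 1"] that by (cases j) auto
        moreover have "cmod (if j < N then u * y j else 0)
            \<le> real (if j < N then (m choose j) * ((m - 1 - j) choose (N - 1 - j)) else 0) * r ^ (Suc m - j)"
          using mult_mono[OF ur yb[of j]] assms(1) unfolding pw[symmetric] by (auto simp: norm_mult mult_ac)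
        ultimately have "cmod (z j) \<le> real ((m choose j) * ((m - 1 - j) choose (N - j))
            + (if j = 0 then 0 else (m choose (j - 1)) * ((m - j) choose (N - j)))
            + (if j < N then (m choose j) * ((m - 1 - j) choose (N - 1 - j)) else 0)) * r ^ (Suc m - j)"
          by (simp only: of_nat_add distrib_right)
        moreover have "j \<le> N" using that by simp
        ultimately show ?thesis by (simp only: hook_tableaux_recursion[OF _ step.hyps(1)])
      qed
      ultimately show ?case by (intro exI[of _ z]) simp
    qed
  qed
qed

text \<open>The factors below \<open>j\<close> give the first binomial coefficient, those above \<open>j\<close> the second.\<close>

lemma lagrange_abs_consecutive:
  assumes "Suc j \<le> N" "N \<le> m"
  shows "lagrange_abs {..<N} real (real m) j = real ((m choose j) * ((m - 1 - j) choose (N - 1 - j)))"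
  using assms
proof (induction N rule: dec_induct)
  case base
  have "{..<Suc j} - {j} = {0..<j}" by auto
  moreover have "(real m - real i) / \<bar>real j - real i\<bar> = real (m - i) / real (j - i)" if "i \<in> {0..<j}" for i
    using that base by (simp add: of_nat_diff)
  ultimately show ?case
    using base by (simp add: lagrange_abs_def binomial_altdef_of_nat)
next
  case (step N)
  have L: "lagrange_abs {..<Suc N} real (real m) j
      = (real m - real N) / \<bar>real j - real N\<bar> * lagrange_abs {..<N} real (real m) j"
    using step lagrange_abs_remove[of "{..<Suc N}" N j] by (simp add: lessThan_Suc)
  define p q where "p = m - 1 - j" and "q = N - 1 - j"
  have pq: "N - j = Suc q" "m - N = p - q" "q < p" using step by (auto simp: p_def q_def)
  have "Suc q * (p choose Suc q) = (p - q) * (p choose q)"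
    by (metis binomial_absorb_comp binomial_absorption)
  then have "real (Suc q) * real (p choose Suc q) = real (p - q) * real (p choose q)"
    by (metis of_nat_mult)
  moreover have "\<bar>real j - real N\<bar> = real (Suc q)" "real m - real N = real (p - q)"
    using step pq by (auto simp: of_nat_diff simp flip: pq(1,2))
  ultimately have "real (p choose Suc q) = (real m - real N) / \<bar>real j - real N\<bar> * real (p choose q)"
    by (simp add: field_simps del: of_nat_Suc)
  moreover have "lagrange_abs {..<N} real (real m) j = real ((m choose j) * (p choose q))"
    using step unfolding p_def q_def by simp
  moreover have "m - 1 - j = p" "Suc N - 1 - j = Suc q" using pq(1) by (simp_all add: p_def)
  ultimately show ?case unfolding L by simp
qed

text \<open>A common factor \<open>u\<^sup>k\<close> reduces the exponents to \<open>0, 1, 2, \<dots>\<close>. The index set starts at an arbitrary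
  \<open>l\<close> because differentiation will remove the smallest index.\<close>

lemma consecutive_interpolation:
  assumes n: "\<And>j. j \<in> {l..<N} \<Longrightarrow> n j = real (k + (j - l))" and "M \<in> \<nat>"
    and "\<And>j. j \<in> {l..<N} \<Longrightarrow> n j < M" "0 < r"
    and "finite U" "U \<subseteq> cball 0 r" "card U \<le> card {l..<N}"
  shows "\<exists>x. (\<forall>u\<in>U. cpow u M = (\<Sum>j\<in>{l..<N}. x j * cpow u (n j))) \<and>
    (\<forall>j\<in>{l..<N}. cmod (x j) \<le> lagrange_abs {l..<N} n M j * r powr (M - n j))"
proof (cases "l < N")
  case False
  then show ?thesis using assms by simp
next
  case True
  define L where "L = N - l"
  obtain M' where M': "M = real M'" using assms(2) by (auto elim: Nats_cases)
  have "N - 1 \<in> {l..<N}" using True by auto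
  then have "n (N - 1) < M" "n (N - 1) = real (k + (N - 1 - l))" by (rule assms(3), rule n)
  then have "k + (N - 1 - l) < M'" using M' by (simp only: of_nat_less_iff)
  define m where "m = M' - k"
  have m: "M' = k + m" "L \<le> m" using \<open>k + (N - 1 - l) < M'\<close> True by (auto simp: m_def L_def)
  have bij: "bij_betw (\<lambda>i. i + l) {..<L} {l..<N}"
    by (rule bij_betwI[where g = "\<lambda>j. j - l"]) (auto simp: L_def)
  obtain x where x: "\<And>u. u \<in> U \<Longrightarrow> u ^ m = (\<Sum>j<L. x j * u ^ j)"
    and xb: "\<And>j. j < L \<Longrightarrow> cmod (x j) \<le> real ((m choose j) * ((m - 1 - j) choose (L - 1 - j))) * r ^ (m - j)"
    using complex_power_interpolation[of r U L m] assms(4-7) m by (auto simp: L_def)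
  have "cpow u M = (\<Sum>j\<in>{l..<N}. x (j - l) * cpow u (n j))" if "u \<in> U" for u
  proof -
    have "(\<Sum>j\<in>{l..<N}. x (j - l) * cpow u (n j)) = (\<Sum>i<L. x i * cpow u (n (i + l)))"
      using sum.reindex_bij_betw[OF bij, of "\<lambda>j. x (j - l) * cpow u (n j)"] by simp
    also have "\<dots> = u ^ k * (\<Sum>i<L. x i * u ^ i)"
      unfolding sum_distrib_left
    proof (intro sum.cong refl)
      fix i assume "i \<in> {..<L}"
      then have "n (i + l) = real (k + i)" using n[of "i + l"] by (auto simp: L_def less_diff_conv)
      then show "x i * cpow u (n (i + l)) = u ^ k * (x i * u ^ i)"
        by (simp only: cpow_nat power_add) (simp add: algebra_simps)
    qed
    also have "\<dots> = cpow u M" unfolding x[OF that, symmetric] M' m cpow_nat power_add ..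
    finally show ?thesis ..
  qed
  moreover have "cmod (x (j - l)) \<le> lagrange_abs {l..<N} n M j * r powr (M - n j)" if j: "j \<in> {l..<N}" for j
  proof -
    have jl: "j - l < L" using j by (auto simp: L_def)
    have "bij_betw (\<lambda>i. i + l) ({..<L} - {j - l}) ({l..<N} - {j})"
      by (rule bij_betwI[where g = "\<lambda>j. j - l"]) (use j in \<open>auto simp: L_def\<close>)
    from prod.reindex_bij_betw[OF this, of "\<lambda>i. (M - n i) / \<bar>n j - n i\<bar>"]
    have "lagrange_abs {l..<N} n M j = (\<Prod>i\<in>{..<L} - {j - l}. (M - n (i + l)) / \<bar>n j - n (i + l)\<bar>)"
      by (simp add: lagrange_abs_def)
    also have "\<dots> = lagrange_abs {..<L} real (real m) (j - l)"
      unfolding lagrange_abs_def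
    proof (intro prod.cong refl)
      fix i assume "i \<in> {..<L} - {j - l}"
      then have "n (i + l) = real (k + i)" using n[of "i + l"] by (auto simp: L_def less_diff_conv)
      then show "(M - n (i + l)) / \<bar>n j - n (i + l)\<bar> = (real m - real i) / \<bar>real (j - l) - real i\<bar>"
        using n[OF j] by (simp add: M' m(1))
    qed
    also have "\<dots> = real ((m choose (j - l)) * ((m - 1 - (j - l)) choose (L - 1 - (j - l))))"
      using lagrange_abs_consecutive[of "j - l" L m] jl m(2) by simp
    finally have "lagrange_abs {l..<N} n M j = real ((m choose (j - l)) * ((m - 1 - (j - l)) choose (L - 1 - (j - l))))" .
    moreover have "M - n j = real (m - (j - l))" using n[OF j] jl m by (simp add: M' of_nat_diff)
    then have "r powr (M - n j) = r ^ (m - (j - l))" using assms(4) by (simp add: powr_realpow)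
    ultimately show ?thesis using xb[OF jl] by simp
  qed
  ultimately show ?thesis by (intro exI[of _ "\<lambda>j. x (j - l)"]) blast
qed

lemma complex_lagrange_interpolation:
  fixes U :: "complex set"
  assumes "finite U"
  shows "\<exists>x. \<forall>u\<in>U. (\<Sum>j<card U. x j * u ^ j) = h u"
proof -
  have "\<exists>p. (p = 0 \<or> degree p < card U) \<and> (\<forall>u\<in>U. poly p u = h u)"
    using assms
  proof (induction U rule: finite_induct)
    case empty
    then show ?case by auto
  next
    case (insert w U)
    then obtain p where p: "p = 0 \<or> degree p < card U" "\<And>u. u \<in> U \<Longrightarrow> poly p u = h u" by blast
    define Z where "Z = (\<Prod>u\<in>U. [:- u, 1:])"
    have Z: "poly Z u = (\<Prod>v\<in>U. u - v)" for u by (simp add: Z_def poly_prod)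
    have deg: "degree Z \<le> card U" unfolding Z_def
      by (rule order_trans[OF degree_prod_sum_le[OF insert.hyps(1)]]) simp
    define q where "q = p + Polynomial.smult ((h w - poly p w) / poly Z w) Z"
    have "degree q \<le> card U"
      unfolding q_def by (rule degree_add_le) (use p(1) deg in \<open>auto intro: order_trans[OF degree_smult_le]\<close>)
    then have "degree q < card (insert w U)" using insert.hyps by simp
    moreover have "poly Z w \<noteq> 0" unfolding Z using insert.hyps by auto
    then have "poly q w = h w" by (simp add: q_def)
    moreover have "poly q u = h u" if "u \<in> U" for u
      using that insert.hyps(1) p(2) by (auto simp: q_def Z)
    ultimately show ?case by auto
  qed
  then obtain p where p: "p = 0 \<or> degree p < card U" "\<And>u. u \<in> U \<Longrightarrow> poly p u = h u" by blast
  have "poly p u = (\<Sum>j<card U. coeff p j * u ^ j)" for u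
  proof (cases "p = 0")
    case False
    then show ?thesis unfolding poly_altdef using p(1)
      by (intro sum.mono_neutral_left) (auto simp: coeff_eq_0)
  qed simp
  then show ?thesis using p(2) by (intro exI[of _ "coeff p"]) simp
qed

lemma consecutive_unisolvent:
  assumes n: "\<And>j. j < N \<Longrightarrow> n j = real (k + j)"
    and "finite U" "card U = N" "0 \<in> U \<Longrightarrow> k = 0"
  shows "\<exists>x. \<forall>u\<in>U. (\<Sum>j<N. x j * cpow u (n j)) = h u"
proof -
  obtain x where x: "\<And>u. u \<in> U \<Longrightarrow> (\<Sum>j<N. x j * u ^ j) = h u / u ^ k"
    using complex_lagrange_interpolation[OF assms(2), of "\<lambda>u. h u / u ^ k"] assms(3) by blast
  have "(\<Sum>j<N. x j * cpow u (n j)) = h u" if "u \<in> U" for u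
  proof -
    have "(\<Sum>j<N. x j * cpow u (n j)) = u ^ k * (\<Sum>j<N. x j * u ^ j)"
      unfolding sum_distrib_left
    proof (intro sum.cong refl)
      fix j assume "j \<in> {..<N}"
      then have "n j = real (k + j)" using n by simp
      then show "x j * cpow u (n j) = u ^ k * (x j * u ^ j)"
        by (simp only: cpow_nat power_add) (simp add: algebra_simps)
    qed
    also have "\<dots> = h u" using x[OF that] assms(4) that by (cases "u = 0") auto
    finally show ?thesis .
  qed
  then show ?thesis by blast
qed

section \<open>Semidefiniteness up to the threshold\<close>

definition power_sum :: "nat set \<Rightarrow> (nat \<Rightarrow> real) \<Rightarrow> real \<Rightarrow> (nat \<Rightarrow> real) \<Rightarrow> real \<Rightarrow> complex \<Rightarrow> complex" where
  "power_sum K n M c c' z = (\<Sum>j\<in>K. of_real (c j) * cpow z (n j)) + of_real c' * cpow z M"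

text \<open>The threshold in a form that makes sense for any finite index set; \<open>threshold_eq\<close> identifies it
  with the ratio of Vandermonde determinants.\<close>

definition power_threshold :: "nat set \<Rightarrow> (nat \<Rightarrow> real) \<Rightarrow> real \<Rightarrow> (nat \<Rightarrow> real) \<Rightarrow> real \<Rightarrow> real" where
  "power_threshold K n M c \<rho> = (\<Sum>j\<in>K. (lagrange_abs K n M j)\<^sup>2 * (\<rho> powr (M - n j) / c j))"

definition consecutive :: "nat set \<Rightarrow> (nat \<Rightarrow> real) \<Rightarrow> real \<Rightarrow> bool" where
  "consecutive K n M \<longleftrightarrow> M \<in> \<nat> \<and> (\<exists>k l N. K = {l..<N} \<and> (\<forall>j\<in>K. n j = real (k + (j - l))))"

text \<open>Both kinds of interpolation in one statement, for the entries of a vector. These may repeat,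
  so there can be fewer nodes than indices.\<close>

lemma interpolation_on:
  fixes u :: "'i \<Rightarrow> complex"
  assumes "finite I" "finite K" "card I \<le> card K" "inj_on n K" "\<And>j. j \<in> K \<Longrightarrow> n j < M" "0 < \<rho>"
    and norm: "\<And>i. i \<in> I \<Longrightarrow> (cmod (u i))\<^sup>2 \<le> \<rho>"
    and dom: "(\<forall>i\<in>I. u i \<in> \<real>\<^sub>\<ge>\<^sub>0 \<and> (u i = 0 \<longrightarrow> (\<forall>j\<in>K. 0 \<le> n j))) \<or> consecutive K n M"
  obtains x where "\<And>i. i \<in> I \<Longrightarrow> cpow (u i) M = (\<Sum>j\<in>K. x j * cpow (u i) (n j))"
    and "\<And>j. j \<in> K \<Longrightarrow> (cmod (x j))\<^sup>2 \<le> (lagrange_abs K n M j)\<^sup>2 * \<rho> powr (M - n j)"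
proof -
  define r where "r = sqrt \<rho>"
  have r: "0 < r" using assms(6) by (simp add: r_def)
  have nr: "cmod (u i) \<le> r" if "i \<in> I" for i
    unfolding r_def by (rule real_le_rsqrt) (rule norm[OF that])
  have r2: "(r powr y)\<^sup>2 = \<rho> powr y" for y
    using assms(6) by (simp add: r_def power2_eq_square flip: powr_mult)
  obtain x where x: "\<forall>i\<in>I. cpow (u i) M = (\<Sum>j\<in>K. x j * cpow (u i) (n j))"
    and xb: "\<forall>j\<in>K. cmod (x j) \<le> lagrange_abs K n M j * r powr (M - n j)"
    using dom
  proof
    assume nn: "\<forall>i\<in>I. u i \<in> \<real>\<^sub>\<ge>\<^sub>0 \<and> (u i = 0 \<longrightarrow> (\<forall>j\<in>K. 0 \<le> n j))"
    define U where "U = (\<lambda>i. Re (u i)) ` I"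
    have re: "u i = of_real (Re (u i))" "0 \<le> Re (u i)" if "i \<in> I" for i
    proof -
      have "u i \<in> \<real>\<^sub>\<ge>\<^sub>0" using nn that by blast
      then show "u i = of_real (Re (u i))" "0 \<le> Re (u i)"
        by (auto simp: complex_nonneg_Reals_iff complex_eq_iff)
    qed
    have "finite U" "card U \<le> card K"
      using assms(1,3) card_image_le[of I "\<lambda>i. Re (u i)"] by (auto simp: U_def)
    moreover have "U \<subseteq> {0..r}"
      using re nr complex_Re_le_cmod order_trans unfolding U_def by fastforce
    moreover have "\<forall>j\<in>K. 0 \<le> n j" if "0 \<in> U"
      using that nn re(1) unfolding U_def by (metis (no_types, lifting) image_iff of_real_0)
    ultimately obtain x where
      "\<forall>t\<in>U. cpow (of_real t) M = (\<Sum>j\<in>K. of_real (x j) * cpow (of_real t) (n j))"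
      "\<forall>j\<in>K. \<bar>x j\<bar> \<le> lagrange_abs K n M j * r powr (M - n j)"
      using nonneg_interpolation[OF assms(2,4,5) r, of U] by blast
    then show thesis using that[of "\<lambda>j. of_real (x j)"] re(1) by (auto simp: U_def)
  next
    assume "consecutive K n M"
    then obtain k l N where K: "K = {l..<N}" and n: "\<And>j. j \<in> {l..<N} \<Longrightarrow> n j = real (k + (j - l))" and "M \<in> \<nat>"
      unfolding consecutive_def by blast
    have "finite (u ` I)" "card (u ` I) \<le> card {l..<N}" "u ` I \<subseteq> cball 0 r"
      using assms(1,3) card_image_le[of I u] nr K by (auto intro: order_trans)
    then obtain x where "\<forall>z\<in>u ` I. cpow z M = (\<Sum>j\<in>{l..<N}. x j * cpow z (n j))"
      "\<forall>j\<in>{l..<N}. cmod (x j) \<le> lagrange_abs {l..<N} n M j * r powr (M - n j)"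
      using consecutive_interpolation[OF n \<open>M \<in> \<nat>\<close> _ r, where U = "u ` I"] assms(5) K by blast
    then show thesis using that K by auto
  qed
  show thesis
  proof (rule that)
    show "cpow (u i) M = (\<Sum>j\<in>K. x j * cpow (u i) (n j))" if "i \<in> I" for i using x that by blast
    show "(cmod (x j))\<^sup>2 \<le> (lagrange_abs K n M j)\<^sup>2 * \<rho> powr (M - n j)" if "j \<in> K" for j
      using power_mono[OF bspec[OF xb that], of 2] by (simp add: power_mult_distrib r2)
  qed
qed

text \<open>With \<open>y \<alpha>\<close> the pairing of \<open>v\<close> and the vector of powers \<open>\<alpha>\<close> of \<open>u\<close>, the quadratic form is
  \<open>\<Sum>j\<in>K. c j |y (n j)|\<^sup>2 + c' |y M|\<^sup>2\<close>, where \<open>y M = \<Sum>j\<in>K. cnj (x j) y (n j)\<close>. By the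
  Cauchy-Schwarz inequality \<open>|y M|\<^sup>2\<close> is at most the threshold times the first sum.\<close>

lemma psd_on_power_sum_rank_one:
  fixes u :: "'i \<Rightarrow> complex"
  assumes "finite I" "finite K" and c: "\<And>j. j \<in> K \<Longrightarrow> 0 < c j"
    and thr: "- 1 \<le> c' * power_threshold K n M c \<rho>"
    and mult: "\<And>i k \<alpha>. i \<in> I \<Longrightarrow> k \<in> I \<Longrightarrow> \<alpha> \<in> insert M (n ` K) \<Longrightarrow>
      cpow (u i * cnj (u k)) \<alpha> = cpow (u i) \<alpha> * cnj (cpow (u k) \<alpha>)"
    and x: "\<And>i. i \<in> I \<Longrightarrow> cpow (u i) M = (\<Sum>j\<in>K. x j * cpow (u i) (n j))"
    and xb: "\<And>j. j \<in> K \<Longrightarrow> (cmod (x j))\<^sup>2 \<le> (lagrange_abs K n M j)\<^sup>2 * \<rho> powr (M - n j)"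
  shows "psd_on I (\<lambda>i k. power_sum K n M c c' (u i * cnj (u k)))"
proof -
  define P where "P \<alpha> i k = cpow (u i) \<alpha> * cnj (cpow (u k) \<alpha>)" for \<alpha> i k
  define y where "y v \<alpha> = (\<Sum>k\<in>I. cnj (cpow (u k) \<alpha>) * v k)" for v \<alpha>
  define a where "a i k = (\<Sum>j\<in>K. of_real (c j) * P (n j) i k) + of_real c' * P M i k" for i k
  have "power_sum K n M c c' (u i * cnj (u k)) = a i k" if "i \<in> I" "k \<in> I" for i k
    using that unfolding power_sum_def a_def P_def by (simp add: mult)
  moreover have "psd_on I a"
    unfolding psd_on_def
  proof (intro conjI allI)
    show "herm_on I a" by (simp add: herm_on_def a_def P_def mult_ac)
    fix v
    define S where "S = (\<Sum>j\<in>K. c j * (cmod (y v (n j)))\<^sup>2)"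
    define T where "T = power_threshold K n M c \<rho>"
    have qP: "qform I (P \<alpha>) v = of_real ((cmod (y v \<alpha>))\<^sup>2)" for \<alpha>
      unfolding P_def[abs_def] qform_rank_one y_def ..
    have q: "Re (qform I a v) = S + c' * (cmod (y v M))\<^sup>2"
      unfolding a_def[abs_def] qform_add qform_sum qform_scale qP S_def by simp
    have S0: "0 \<le> S" unfolding S_def using c by (intro sum_nonneg) (auto simp: less_imp_le)
    have "y v M = (\<Sum>k\<in>I. \<Sum>j\<in>K. cnj (x j) * (cnj (cpow (u k) (n j)) * v k))"
      unfolding y_def by (intro sum.cong refl) (simp add: x sum_distrib_right sum_distrib_left mult.assoc)
    also have "\<dots> = (\<Sum>j\<in>K. cnj (x j) * y v (n j))"
      unfolding y_def sum_distrib_left by (rule sum.swap)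
    finally have "cmod (y v M) \<le> (\<Sum>j\<in>K. cmod (x j) * cmod (y v (n j)))"
      using norm_sum[of "\<lambda>j. cnj (x j) * y v (n j)" K] by (simp add: norm_mult)
    also have "\<dots> = (\<Sum>j\<in>K. (cmod (x j) / sqrt (c j)) * (sqrt (c j) * cmod (y v (n j))))"
      by (intro sum.cong refl) (use c in force)
    finally have "(cmod (y v M))\<^sup>2 \<le> (\<Sum>j\<in>K. (cmod (x j) / sqrt (c j)) * (sqrt (c j) * cmod (y v (n j))))\<^sup>2"
      by (rule power_mono) simp
    also have "\<dots> \<le> (\<Sum>j\<in>K. (cmod (x j) / sqrt (c j))\<^sup>2) * (\<Sum>j\<in>K. (sqrt (c j) * cmod (y v (n j)))\<^sup>2)"
      by (rule Cauchy_Schwarz_ineq_sum)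
    also have "(\<Sum>j\<in>K. (sqrt (c j) * cmod (y v (n j)))\<^sup>2) = S"
      unfolding S_def by (intro sum.cong refl) (use c in \<open>simp add: power_mult_distrib less_imp_le\<close>)
    also have "(\<Sum>j\<in>K. (cmod (x j) / sqrt (c j))\<^sup>2) * S \<le> T * S"
    proof (rule mult_right_mono[OF _ S0])
      show "(\<Sum>j\<in>K. (cmod (x j) / sqrt (c j))\<^sup>2) \<le> T"
        unfolding T_def power_threshold_def
      proof (rule sum_mono)
        fix j assume j: "j \<in> K"
        have "(cmod (x j) / sqrt (c j))\<^sup>2 = (cmod (x j))\<^sup>2 / c j"
          using c[OF j] by (simp add: power_divide less_imp_le)
        then show "(cmod (x j) / sqrt (c j))\<^sup>2 \<le> (lagrange_abs K n M j)\<^sup>2 * (\<rho> powr (M - n j) / c j)"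
          using divide_right_mono[OF xb[OF j], of "c j"] c[OF j] by simp
      qed
    qed
    finally have yM: "(cmod (y v M))\<^sup>2 \<le> T * S" .
    show "0 \<le> Re (qform I a v)"
    proof (cases "0 \<le> c'")
      case True
      then show ?thesis using S0 by (simp add: q)
    next
      case False
      have "- 1 * S \<le> (c' * T) * S" using thr S0 unfolding T_def by (rule mult_right_mono)
      also have "\<dots> \<le> c' * (cmod (y v M))\<^sup>2"
        using mult_left_mono_neg[OF yM, of c'] False by (simp add: mult.assoc)
      finally show ?thesis by (simp add: q)
    qed
  qed
  ultimately show ?thesis using psd_on_cong[of I "\<lambda>i k. power_sum K n M c c' (u i * cnj (u k))" a] by blast
qed

lemma power_threshold_nonneg:
  assumes "\<And>j. j \<in> K \<Longrightarrow> 0 < c j"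
  shows "0 \<le> power_threshold K n M c \<rho>"
  unfolding power_threshold_def using assms by (intro sum_nonneg mult_nonneg_nonneg) (auto simp: less_imp_le)

lemma power_threshold_pos:
  assumes "finite K" "K \<noteq> {}" "inj_on n K" "\<And>j. j \<in> K \<Longrightarrow> n j < M" "\<And>j. j \<in> K \<Longrightarrow> 0 < c j" "0 < \<rho>"
  shows "0 < power_threshold K n M c \<rho>"
  unfolding power_threshold_def
proof (rule sum_pos[OF assms(1,2)])
  fix j assume j: "j \<in> K"
  have "0 < lagrange_abs K n M j"
    unfolding lagrange_abs_def
    by (rule prod_pos) (use assms(3,4) j in \<open>auto intro!: divide_pos_pos dest: inj_onD\<close>)
  then show "0 < (lagrange_abs K n M j)\<^sup>2 * (\<rho> powr (M - n j) / c j)"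
    using assms(5)[OF j] assms(6) by simp
qed

text \<open>Termwise, the left side carries the factor \<open>M / n j\<close> and the right side the square of
  \<open>(M - n k) / (n j - n k)\<close>. As \<open>0 \<le> n k < n j < M\<close>, that fraction is at least \<open>M / n j\<close> and at least \<open>1\<close>.\<close>

lemma power_threshold_derivative:
  assumes "finite K" "k \<in> K" and M: "\<And>j. j \<in> K \<Longrightarrow> n j < M" and c: "\<And>j. j \<in> K \<Longrightarrow> 0 < c j"
    and min: "\<And>j. j \<in> K - {k} \<Longrightarrow> n k < n j" and "0 \<le> n k"
  shows "M * power_threshold (K - {k}) (\<lambda>j. n j - 1) (M - 1) (\<lambda>j. c j * n j) \<rho> \<le> power_threshold K n M c \<rho>"
proof -
  define L where "L j = lagrange_abs (K - {k}) n M j" for j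
  have "M * power_threshold (K - {k}) (\<lambda>j. n j - 1) (M - 1) (\<lambda>j. c j * n j) \<rho>
      = (\<Sum>j\<in>K - {k}. M / n j * ((L j)\<^sup>2 * (\<rho> powr (M - n j) / c j)))"
    unfolding power_threshold_def sum_distrib_left
    by (intro sum.cong refl) (simp add: L_def lagrange_abs_def)
  also have "\<dots> \<le> (\<Sum>j\<in>K - {k}. (lagrange_abs K n M j)\<^sup>2 * (\<rho> powr (M - n j) / c j))"
  proof (rule sum_mono)
    fix j assume j: "j \<in> K - {k}"
    have nj: "n k < n j" "n j < M" "0 < c j" using min[OF j] M c j by auto
    have "M / n j \<le> (M - n k) / (n j - n k)"
    proof -
      have "n k * n j \<le> n k * M" using nj assms(6) by (intro mult_left_mono) auto
      then have "M * (n j - n k) \<le> (M - n k) * n j" by (simp add: algebra_simps)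
      then show ?thesis using nj assms(6) by (simp add: field_simps)
    qed
    also have "\<dots> \<le> ((M - n k) / (n j - n k))\<^sup>2"
      using nj by (intro self_le_power) auto
    finally have "M / n j * ((L j)\<^sup>2 * (\<rho> powr (M - n j) / c j))
        \<le> ((M - n k) / (n j - n k))\<^sup>2 * ((L j)\<^sup>2 * (\<rho> powr (M - n j) / c j))"
      using nj by (intro mult_right_mono) auto
    also have "\<dots> = (lagrange_abs K n M j)\<^sup>2 * (\<rho> powr (M - n j) / c j)"
      using lagrange_abs_remove[OF assms(1,2), of j n M] j nj
      by (simp add: L_def power_mult_distrib power_divide)
    finally show "M / n j * ((L j)\<^sup>2 * (\<rho> powr (M - n j) / c j))
        \<le> (lagrange_abs K n M j)\<^sup>2 * (\<rho> powr (M - n j) / c j)" .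
  qed
  also have "\<dots> \<le> power_threshold K n M c \<rho>"
    unfolding power_threshold_def using assms(1) c
    by (intro sum_mono2) (auto simp: less_imp_le)
  finally show ?thesis .
qed

lemma herm_on_power_sum:
  assumes "herm_on I a" "\<And>\<alpha>. \<alpha> \<in> insert M (n ` K) \<Longrightarrow> \<alpha> \<in> \<nat> \<or> nonneg_entries I a"
  shows "herm_on I (\<lambda>i k. power_sum K n M c c' (a i k))"
proof -
  have "cnj (cpow (a i k) \<alpha>) = cpow (a k i) \<alpha>" if "\<alpha> \<in> insert M (n ` K)" "i \<in> I" "k \<in> I" for \<alpha> i k
    using herm_on_cpow[OF assms(1) assms(2)[OF that(1)]] that by (simp add: herm_on_def)
  then show ?thesis by (simp add: herm_on_def power_sum_def)
qed

lemma power_sum_segment: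
  assumes "\<And>\<alpha>. \<alpha> \<in> insert M (n ` K) \<Longrightarrow> \<alpha> \<in> \<nat> \<or> 0 \<le> \<alpha> \<and> p \<in> \<real>\<^sub>\<ge>\<^sub>0 \<and> q \<in> \<real>\<^sub>\<ge>\<^sub>0"
  shows "continuous_on {0..1} (\<lambda>t. power_sum K n M c c' (p + of_real t * (q - p)))"
    and "0 < t \<Longrightarrow> t < 1 \<Longrightarrow> ((\<lambda>t. power_sum K n M c c' (p + of_real t * (q - p))) has_vector_derivative
      (q - p) * power_sum K (\<lambda>j. n j - 1) (M - 1) (\<lambda>j. c j * n j) (c' * M) (p + of_real t * (q - p))) (at t)"
proof -
  show "continuous_on {0..1} (\<lambda>t. power_sum K n M c c' (p + of_real t * (q - p)))"
    unfolding power_sum_def using assms by (intro continuous_intros cpow_segment(1)) auto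
  assume t: "0 < t" "t < 1"
  have "((\<lambda>t. power_sum K n M c c' (p + of_real t * (q - p))) has_vector_derivative
      (\<Sum>j\<in>K. of_real (c j) * ((q - p) * (of_real (n j) * cpow (p + of_real t * (q - p)) (n j - 1))))
      + of_real c' * ((q - p) * (of_real M * cpow (p + of_real t * (q - p)) (M - 1)))) (at t)"
    unfolding power_sum_def using assms t
    by (intro has_vector_derivative_add has_vector_derivative_sum has_vector_derivative_mult_right cpow_segment(2)) auto
  then show "((\<lambda>t. power_sum K n M c c' (p + of_real t * (q - p))) has_vector_derivative
      (q - p) * power_sum K (\<lambda>j. n j - 1) (M - 1) (\<lambda>j. c j * n j) (c' * M) (p + of_real t * (q - p))) (at t)"
    by (rule has_vector_derivative_eq_rhs) (simp add: power_sum_def distrib_left sum_distrib_left mult_ac)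
qed

text \<open>The two ways in which the exponents may fit the entries of \<open>a\<close>. Both pass to the smaller problem
  of the induction below, which has one row less, no longer contains the smallest exponent, and lowers the others
  by one.\<close>

definition admissible :: "'i set \<Rightarrow> ('i \<Rightarrow> 'i \<Rightarrow> complex) \<Rightarrow> nat set \<Rightarrow> (nat \<Rightarrow> real) \<Rightarrow> real \<Rightarrow> bool" where
  "admissible I a K n M \<longleftrightarrow>
     nonneg_entries I a \<and> (\<forall>\<alpha>\<in>insert M (n ` K). \<alpha> \<in> \<nat> \<or> real (card I) - 1 \<le> \<alpha>) \<or> consecutive K n M"

lemma admissible_exponent:
  assumes "admissible I a K n M" "\<alpha> \<in> insert M (n ` K)"
  shows "\<alpha> \<in> \<nat> \<or> nonneg_entries I a \<and> real (card I) - 1 \<le> \<alpha>"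
  using assms unfolding admissible_def consecutive_def by (auto simp del: of_nat_add)

lemma Nats_pred: "\<alpha> \<in> \<nat> \<Longrightarrow> 0 < \<alpha> \<Longrightarrow> \<alpha> - 1 \<in> (\<nat> :: real set)"
  by (elim Nats_cases) (metis Nats_1 Nats_diff le_numeral_extra(4) of_nat_0_less_iff of_nat_1 of_nat_in_Nats of_nat_mono Suc_leI One_nat_def)

text \<open>The same peeling as for single powers. On the smaller set the derivative of the power
  sum, with its smallest exponent split off, is again a power sum of the right size, and
  \<open>power_threshold_derivative\<close> shows that it obeys its own threshold.\<close>

lemma psd_on_power_sum:
  assumes "finite I" "finite K" "card K = card I" "inj_on n K" "\<And>j. j \<in> K \<Longrightarrow> n j < M"
    and "\<And>j. j \<in> K \<Longrightarrow> 0 < c j" "0 < \<rho>" "psd_on I a" "\<And>i. i \<in> I \<Longrightarrow> cmod (a i i) \<le> \<rho>"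
    and "- 1 \<le> c' * power_threshold K n M c \<rho>" "admissible I a K n M"
  shows "psd_on I (\<lambda>i k. power_sum K n M c c' (a i k))"
  using assms
proof (induction I arbitrary: K n M c c' a rule: finite_induct)
  case empty
  show ?case by (rule psd_on_empty)
next
  case (insert p I)
  note finK = insert.prems(1) and cardK = insert.prems(2) and inj = insert.prems(3) and nM = insert.prems(4)
    and cpos = insert.prems(5) and psd = insert.prems(7) and diag = insert.prems(8)
    and thr = insert.prems(9) and adm = insert.prems(10)
  have fin: "finite (insert p I)" and pin: "p \<in> insert p I" using insert.hyps(1) by simp_all
  have card: "card (insert p I) = Suc (card I)" using insert.hyps by simp
  define F where "F = power_sum K n M c c'"
  define F' where "F' = power_sum K (\<lambda>j. n j - 1) (M - 1) (\<lambda>j. c j * n j) (c' * M)"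
  have expo: "\<alpha> \<in> \<nat> \<or> nonneg_entries (insert p I) a \<and> real (card I) \<le> \<alpha>" if "\<alpha> \<in> insert M (n ` K)" for \<alpha>
    using admissible_exponent[OF adm that] unfolding card by simp
  then have expo0: "0 \<le> \<alpha>" if "\<alpha> \<in> insert M (n ` K)" for \<alpha>
    using that by (metis Nats_altdef1 Nats_cases of_nat_0_le_iff order_trans)
  define u where "u i = a i p / of_real (sqrt (Re (a p p)))" for i
  define b where "b i k = u i * cnj (u k)" for i k
  note peel = psd_on_peel[OF fin psd pin u_def, folded b_def]
  have un: "u i \<in> \<real>\<^sub>\<ge>\<^sub>0" if "nonneg_entries (insert p I) a" "i \<in> insert p I" for i
    unfolding u_def by (rule nonneg_entries_peel[OF fin psd that(1) pin that(2)])
  have bn: "nonneg_entries (insert p I) b" if "nonneg_entries (insert p I) a"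
    unfolding b_def[abs_def] using un[OF that] by (rule nonneg_entries_rank_one)
  have Fb: "psd_on (insert p I) (\<lambda>i k. F (b i k))"
  proof -
    have "(\<forall>i\<in>insert p I. u i \<in> \<real>\<^sub>\<ge>\<^sub>0 \<and> (u i = 0 \<longrightarrow> (\<forall>j\<in>K. 0 \<le> n j))) \<or> consecutive K n M"
      using adm un expo0 unfolding admissible_def by auto
    moreover have "(cmod (u i))\<^sup>2 \<le> \<rho>" if "i \<in> insert p I" for i
      using peel(4)[OF that] diag[OF that] by simp
    ultimately obtain x where "\<And>i. i \<in> insert p I \<Longrightarrow> cpow (u i) M = (\<Sum>j\<in>K. x j * cpow (u i) (n j))"
      "\<And>j. j \<in> K \<Longrightarrow> (cmod (x j))\<^sup>2 \<le> (lagrange_abs K n M j)\<^sup>2 * \<rho> powr (M - n j)"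
      using interpolation_on[OF fin finK _ inj nM insert.prems(6), of u] cardK by auto
    then show ?thesis unfolding F_def b_def
      using expo un by (intro psd_on_power_sum_rank_one[OF fin finK cpos thr] cpow_rank_one) blast+
  qed
  obtain k where k: "k \<in> K" "\<And>j. j \<in> K \<Longrightarrow> n k \<le> n j"
  proof -
    have "K \<noteq> {}" using cardK card by auto
    then show thesis using that finK arg_min_least[of K _ n] arg_min_if_finite(1)[of K n] by blast
  qed
  have kmin: "n k < n j" if "j \<in> K - {k}" for j
    using k inj that by (metis Diff_iff inj_onD insertI1 order_le_less)
  define K' where "K' = K - {k}"
  have K': "finite K'" "card K' = card I" "K = insert k K'" "k \<notin> K'"
    using finK cardK card k(1) by (auto simp: K'_def)
  have diff: "psd_on I (\<lambda>i j. F (a i j) - F (b i j))"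
  proof (cases "I = {}")
    case True
    then show ?thesis by (simp add: psd_on_empty)
  next
    case False
    have sub: "psd_on I d" if "psd_on (insert p I) d" for d
      using psd_on_subset[OF that subset_insertI fin] .
    have nnI: "nonneg_entries I d" if "nonneg_entries (insert p I) d" for d
      using that by (auto simp: nonneg_entries_def)
    have psdI: "psd_on I a" "psd_on I b" "psd_on I (\<lambda>i k. a i k - b i k)"
      using sub psd peel(1) psd_on_rank_one[of I u] unfolding b_def[abs_def] by auto
    show ?thesis unfolding F_def
    proof (rule psd_on_mono_by_derivative[where f' = F', OF insert.hyps(1) psdI(3)])
      show "herm_on I (\<lambda>i k. power_sum K n M c c' (a i k))" "herm_on I (\<lambda>i k. power_sum K n M c c' (b i k))"
        using psdI expo bn nnI unfolding psd_on_def by (blast intro: herm_on_power_sum)+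
      fix i j assume ij: "i \<in> I" "j \<in> I"
      have seg: "\<alpha> \<in> \<nat> \<or> 0 \<le> \<alpha> \<and> b i j \<in> \<real>\<^sub>\<ge>\<^sub>0 \<and> a i j \<in> \<real>\<^sub>\<ge>\<^sub>0" if "\<alpha> \<in> insert M (n ` K)" for \<alpha>
        using expo[OF that] expo0[OF that] bn ij unfolding nonneg_entries_def by blast
      show "continuous_on {0..1} (\<lambda>t. power_sum K n M c c' (b i j + of_real t * (a i j - b i j)))"
        by (rule power_sum_segment(1)[OF seg])
      show "((\<lambda>t. power_sum K n M c c' (b i j + of_real t * (a i j - b i j))) has_vector_derivative
          (a i j - b i j) * F' (b i j + of_real t * (a i j - b i j))) (at t)" if "0 < t" "t < 1" for t
        unfolding F'_def by (rule power_sum_segment(2)[OF seg that])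
    next
      fix t :: real assume t: "0 < t" "t < 1"
      define d where "d i j = b i j + of_real t * (a i j - b i j)" for i j
      have dpsd: "psd_on I d" unfolding d_def[abs_def] using t by (intro psd_on_segment psdI) auto
      have dnn: "nonneg_entries I d" if "nonneg_entries (insert p I) a"
        unfolding d_def[abs_def] using t that bn by (intro nonneg_entries_segment nnI) auto
      have ddiag: "cmod (d i i) \<le> \<rho>" if "i \<in> I" for i
      proof -
        have "cmod (b i i) \<le> \<rho>"
          using peel(4)[of i] diag[of i] that unfolding b_def by (simp add: norm_mult power2_eq_square)
        have "d i i = of_real (1 - t) * b i i + of_real t * a i i" by (simp add: d_def algebra_simps)
        then have "cmod (d i i) \<le> (1 - t) * cmod (b i i) + t * cmod (a i i)"
          using t norm_triangle_ineq[of "of_real (1 - t) * b i i" "of_real t * a i i"]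
          by (simp add: norm_mult del: of_real_diff)
        also have "\<dots> \<le> (1 - t) * \<rho> + t * \<rho>"
          using t that diag \<open>cmod (b i i) \<le> \<rho>\<close> by (intro add_mono mult_left_mono) auto
        finally show ?thesis by (simp add: algebra_simps)
      qed
      have split: "F' z = of_real (c k * n k) * cpow z (n k - 1)
          + power_sum K' (\<lambda>j. n j - 1) (M - 1) (\<lambda>j. c j * n j) (c' * M) z" for z
        using K'(1,4) unfolding F'_def power_sum_def K'(3) by simp
      \<comment> \<open>the smallest power is superfluous for the induction, and semidefinite on its own\<close>
      have "psd_on I (\<lambda>i j. of_real (c k * n k) * cpow (d i j) (n k - 1))"
      proof (cases "n k = 0")
        case True
        then show ?thesis by (simp add: psd_on_zero)
      next
        case False
        then have "0 < n k" using expo0[of "n k"] k(1) by (auto simp: order_less_le)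
        then have "n k - 1 \<in> \<nat> \<or> nonneg_entries I d \<and> real (card I) - 2 \<le> n k - 1"
          using expo[of "n k"] k(1) dnn Nats_pred by auto
        then have "psd_on I (\<lambda>i j. cpow (d i j) (n k - 1))" by (rule psd_on_cpow[OF insert.hyps(1) dpsd])
        then show ?thesis by (rule psd_on_scale[rotated]) (use \<open>0 < n k\<close> cpos[OF k(1)] in simp)
      qed
      moreover have "psd_on I (\<lambda>i j. power_sum K' (\<lambda>j. n j - 1) (M - 1) (\<lambda>j. c j * n j) (c' * M) (d i j))"
      proof (rule insert.IH[OF K'(1,2) _ _ _ insert.prems(6) dpsd ddiag])
        have npos: "0 < n j" if "j \<in> K'" for j
          using kmin[of j] expo0[of "n k"] k(1) that by (auto simp: K'_def)
        have Mpos: "0 < M" using nM[OF k(1)] expo0[of "n k"] k(1) by simp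
        show "inj_on (\<lambda>j. n j - 1) K'" using inj by (auto simp: inj_on_def K'_def)
        show "n j - 1 < M - 1" if "j \<in> K'" for j using nM that by (simp add: K'_def)
        show "0 < c j * n j" if "j \<in> K'" for j using cpos npos that by (simp add: K'_def)
        show "- 1 \<le> c' * M * power_threshold K' (\<lambda>j. n j - 1) (M - 1) (\<lambda>j. c j * n j) \<rho>" (is "_ \<le> _ * ?T'")
        proof (cases "0 \<le> c'")
          case True
          moreover have "0 \<le> ?T'" using cpos npos by (intro power_threshold_nonneg) (auto simp: K'_def)
          ultimately have "0 \<le> c' * M * ?T'" using Mpos by simp
          then show ?thesis by simp
        next
          case False
          have "M * ?T' \<le> power_threshold K n M c \<rho>"
            unfolding K'_def using kmin expo0[of "n k"] k(1)
            by (intro power_threshold_derivative finK nM cpos) auto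
          then have "c' * power_threshold K n M c \<rho> \<le> c' * (M * ?T')"
            using False by (intro mult_left_mono_neg) auto
          then show ?thesis using thr by (simp add: mult.assoc)
        qed
        show "admissible I d K' (\<lambda>j. n j - 1) (M - 1)"
          using adm unfolding admissible_def[of "insert p I"]
        proof
          assume *: "nonneg_entries (insert p I) a \<and> (\<forall>\<alpha>\<in>insert M (n ` K). \<alpha> \<in> \<nat> \<or> real (card (insert p I)) - 1 \<le> \<alpha>)"
          have "\<alpha> - 1 \<in> \<nat> \<or> real (card I) - 1 \<le> \<alpha> - 1" if "\<alpha> \<in> insert M (n ` K')" for \<alpha>
          proof -
            have "\<alpha> \<in> insert M (n ` K)" "0 < \<alpha>" using that npos Mpos by (auto simp: K'_def)
            then show ?thesis using expo[of \<alpha>] Nats_pred[of \<alpha>] by auto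
          qed
          then show ?thesis unfolding admissible_def using dnn * by auto
        next
          assume "consecutive K n M"
          then obtain m l N where cons: "M \<in> \<nat>" "K = {l..<N}" "\<forall>j\<in>K. n j = real (m + (j - l))"
            unfolding consecutive_def by blast
          \<comment> \<open>the smallest exponent sits at the smallest index\<close>
          have "l \<in> K" using k(1) cons(2) by auto
          then have "n k \<le> n l" by (rule k(2))
          then have "k = l" using cons(3) \<open>l \<in> K\<close> k(1) cons(2) by auto
          have "n j - 1 = real (m + (j - Suc l))" if "j \<in> {Suc l..<N}" for j
          proof -
            have "j - l = Suc (j - Suc l)" using that by auto
            then show ?thesis using cons(2,3) that by auto
          qed
          moreover have "K' = {Suc l..<N}" using cons(2) \<open>k = l\<close> by (auto simp: K'_def)
          ultimately have "consecutive K' (\<lambda>j. n j - 1) (M - 1)"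
            unfolding consecutive_def using Nats_pred[OF cons(1) Mpos] by blast
          then show ?thesis by (simp add: admissible_def)
        qed
      qed
      ultimately show "psd_on I (\<lambda>i j. F' (b i j + of_real t * (a i j - b i j)))"
        unfolding split d_def[symmetric] by (rule psd_on_add)
    qed
  qed
  have 2: "psd_on (insert p I) (\<lambda>i k. F (a i k) - F (b i k))"
  proof (rule psd_on_extend_zero[OF _ fin, where p = p])
    have "insert p I - {p} = I" using insert.hyps by simp
    with diff show "psd_on (insert p I - {p}) (\<lambda>i k. F (a i k) - F (b i k))" by (simp only:)
    show "F (a i p) - F (b i p) = 0 \<and> F (a p i) - F (b p i) = 0" if "i \<in> insert p I" for i
      unfolding peel(2)[OF that] peel(3)[OF that] by simp
  qed
  have "F (b i k) + (F (a i k) - F (b i k)) = F (a i k)" for i k by simp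
  then show ?case using psd_on_add[OF Fb 2] unfolding F_def by (simp only:)
qed

section \<open>Definiteness\<close>

text \<open>The form is \<open>\<Sum>j\<in>K. c j |y v j|\<^sup>2\<close>. If every \<open>y v j\<close> vanishes, so does the pairing of \<open>v\<close> with any
  combination of the power vectors, and by assumption these include the unit vectors.\<close>

lemma pd_on_positive_power_sum_rank_one:
  fixes u :: "'i \<Rightarrow> complex"
  assumes "finite I" and c: "\<And>j. j \<in> K \<Longrightarrow> 0 < c j" and "finite K"
    and mult: "\<And>i k j. i \<in> I \<Longrightarrow> k \<in> I \<Longrightarrow> j \<in> K \<Longrightarrow>
      cpow (u i * cnj (u k)) (n j) = cpow (u i) (n j) * cnj (cpow (u k) (n j))"
    and sep: "\<And>p. p \<in> I \<Longrightarrow> \<exists>x. \<forall>i\<in>I. (\<Sum>j\<in>K. x j * cpow (u i) (n j)) = (if i = p then 1 else 0)"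
  shows "pd_on I (\<lambda>i k. \<Sum>j\<in>K. of_real (c j) * cpow (u i * cnj (u k)) (n j))" (is "pd_on I ?a")
proof -
  define y where "y v j = (\<Sum>k\<in>I. cnj (cpow (u k) (n j)) * v k)" for v j
  have a: "?a i k = (\<Sum>j\<in>K. of_real (c j) * (cpow (u i) (n j) * cnj (cpow (u k) (n j))))"
    if "i \<in> I" "k \<in> I" for i k
    using that by (simp add: mult)
  have "herm_on I ?a" unfolding herm_on_def by (simp add: a mult_ac)
  moreover have "0 < Re (qform I ?a v)" if pI: "p \<in> I" and vp0: "v p \<noteq> 0" for v p
  proof -
    have "qform I ?a v = qform I (\<lambda>i k. \<Sum>j\<in>K. of_real (c j) * (cpow (u i) (n j) * cnj (cpow (u k) (n j)))) v"
      by (rule qform_cong) (rule a)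
    also have "\<dots> = (\<Sum>j\<in>K. of_real (c j) * of_real ((cmod (y v j))\<^sup>2))"
      unfolding qform_sum qform_scale qform_rank_one y_def ..
    finally have "qform I ?a v = (\<Sum>j\<in>K. of_real (c j) * of_real ((cmod (y v j))\<^sup>2))" .
    then have q: "Re (qform I ?a v) = (\<Sum>j\<in>K. c j * (cmod (y v j))\<^sup>2)" by simp
    obtain x where x: "\<And>i. i \<in> I \<Longrightarrow> (\<Sum>j\<in>K. x j * cpow (u i) (n j)) = (if i = p then 1 else 0)"
      using sep[OF pI] by blast
    have "(\<Sum>j\<in>K. cnj (x j) * y v j) = (\<Sum>k\<in>I. \<Sum>j\<in>K. cnj (x j) * (cnj (cpow (u k) (n j)) * v k))"
      unfolding y_def sum_distrib_left by (rule sum.swap)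
    also have "\<dots> = (\<Sum>k\<in>I. cnj (\<Sum>j\<in>K. x j * cpow (u k) (n j)) * v k)"
      by (simp add: sum_distrib_right mult.assoc)
    also have "\<dots> = (\<Sum>k\<in>I. if k = p then v k else 0)"
      by (intro sum.cong refl) (simp only: x, simp)
    also have "\<dots> = v p" using pI assms(1) by simp
    finally have vp: "(\<Sum>j\<in>K. cnj (x j) * y v j) = v p" .
    have "\<exists>j\<in>K. y v j \<noteq> 0"
    proof (rule ccontr)
      assume "\<not> ?thesis"
      then have "(\<Sum>j\<in>K. cnj (x j) * y v j) = 0" by (intro sum.neutral) auto
      then show False using vp vp0 by simp
    qed
    then obtain j where j: "j \<in> K" "y v j \<noteq> 0" by blast
    have "0 < c j * (cmod (y v j))\<^sup>2" using j c by simp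
    also have "\<dots> \<le> Re (qform I ?a v)"
      unfolding q using j assms(3) c by (intro member_le_sum) (auto simp: less_imp_le)
    finally show ?thesis .
  qed
  ultimately show ?thesis unfolding pd_on_def by blast
qed

lemma unisolvent_on:
  fixes u :: "'i \<Rightarrow> complex"
  assumes "finite I" "finite K" "card K = card I" "inj_on n K" "inj_on u I" "p \<in> I"
    and zero: "\<And>i. i \<in> I \<Longrightarrow> u i = 0 \<Longrightarrow> \<exists>j\<in>K. n j = 0"
    and dom: "(\<forall>i\<in>I. u i \<in> \<real>\<^sub>\<ge>\<^sub>0) \<or> (\<exists>k N. K = {..<N} \<and> (\<forall>j<N. n j = real (k + j)))"
  shows "\<exists>x. \<forall>i\<in>I. (\<Sum>j\<in>K. x j * cpow (u i) (n j)) = (if i = p then 1 else 0)"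
  using dom
proof
  assume nn: "\<forall>i\<in>I. u i \<in> \<real>\<^sub>\<ge>\<^sub>0"
  have re: "u i = of_real (Re (u i))" "0 \<le> Re (u i)" if "i \<in> I" for i
  proof -
    have "u i \<in> \<real>\<^sub>\<ge>\<^sub>0" using nn that by blast
    then show "u i = of_real (Re (u i))" "0 \<le> Re (u i)"
      by (auto simp: complex_nonneg_Reals_iff complex_eq_iff)
  qed
  define U where "U = (\<lambda>i. Re (u i)) ` I"
  have inj: "inj_on (\<lambda>i. Re (u i)) I"
    by (rule inj_onI) (metis assms(5) inj_onD re(1))
  then have "card K = card U" using assms(3) by (simp add: U_def card_image)
  moreover have "finite U" "U \<subseteq> {0..}" using assms(1) re by (auto simp: U_def)
  moreover have "\<exists>j\<in>K. n j = 0" if "0 \<in> U"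
    using that zero re(1) unfolding U_def by (metis (no_types, lifting) image_iff of_real_0)
  ultimately obtain x where x: "\<forall>t\<in>U. (\<Sum>j\<in>K. of_real (x j) * cpow (of_real t) (n j))
      = of_real (if t = Re (u p) then 1 else 0)"
    using nonneg_unisolvent[OF assms(2,4), of U "\<lambda>t. if t = Re (u p) then 1 else 0"] by blast
  have "(\<Sum>j\<in>K. of_real (x j) * cpow (u i) (n j)) = (if i = p then 1 else 0)" if "i \<in> I" for i
  proof -
    have "Re (u i) = Re (u p) \<longleftrightarrow> i = p" using inj that assms(6) by (auto dest: inj_onD)
    moreover have "Re (u i) \<in> U" using that by (simp add: U_def)
    ultimately show ?thesis using bspec[OF x, of "Re (u i)"] re(1)[OF that] by simp
  qed
  then show ?thesis by (intro exI[of _ "\<lambda>j. of_real (x j)"]) simp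
next
  assume "\<exists>k N. K = {..<N} \<and> (\<forall>j<N. n j = real (k + j))"
  then obtain k N where K: "K = {..<N}" "\<And>j. j < N \<Longrightarrow> n j = real (k + j)" by blast
  have "card (u ` I) = N" using assms(3,5) K(1) by (simp add: card_image)
  moreover have "k = 0" if z: "0 \<in> u ` I"
  proof -
    obtain j where "j < N" "n j = 0" using z zero K(1) by fastforce
    then show ?thesis using K(2)[of j] by simp
  qed
  ultimately obtain x where x: "\<forall>z\<in>u ` I. (\<Sum>j<N. x j * cpow z (n j)) = (if z = u p then 1 else 0)"
    using consecutive_unisolvent[of N n k "u ` I" "\<lambda>z. if z = u p then 1 else 0"] K(2) assms(1) by blast
  have "(\<Sum>j\<in>K. x j * cpow (u i) (n j)) = (if i = p then 1 else 0)" if "i \<in> I" for i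
    using bspec[OF x, of "u i"] that inj_onD[OF assms(5) _ that assms(6)] unfolding K(1) by auto
  then show ?thesis by blast
qed

text \<open>Distinct rows define distinct polynomials in \<open>s\<close>, and only finitely many \<open>s\<close> are roots of a difference of two
  of these or of a nonzero one.\<close>

lemma separating_powers:
  fixes a :: "nat \<Rightarrow> nat \<Rightarrow> complex"
  assumes "finite I" and dist: "\<And>i i'. i \<in> I \<Longrightarrow> i' \<in> I \<Longrightarrow> i \<noteq> i' \<Longrightarrow> \<exists>k\<in>I. a i k \<noteq> a i' k"
  obtains s :: real where "0 < s" "inj_on (\<lambda>i. \<Sum>k\<in>I. a i k * of_real s ^ k) I"
    and "\<And>i. i \<in> I \<Longrightarrow> (\<Sum>k\<in>I. a i k * of_real s ^ k) = 0 \<Longrightarrow> \<forall>k\<in>I. a i k = 0"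
proof -
  \<comment> \<open>row \<open>i\<close> read as a list of coefficients\<close>
  define P where "P i = (\<Sum>k\<in>I. monom (a i k) k)" for i
  have P: "poly (P i) z = (\<Sum>k\<in>I. a i k * z ^ k)" for i z
    by (simp add: P_def poly_sum poly_monom)
  have coeff: "coeff (P i) k = a i k" if "k \<in> I" for i k
    using that assms(1) by (simp add: P_def coeff_sum)
  define Q where "Q = {q \<in> P ` I \<union> (\<lambda>(i, i'). P i - P i') ` (I \<times> I). q \<noteq> 0}"
  define B where "B = (\<Union>q\<in>Q. {z. poly q z = 0})"
  have "finite Q" unfolding Q_def using assms(1) by simp
  then have "finite B" unfolding B_def by (intro finite_UN_I poly_roots_finite) (auto simp: Q_def)
  then have "finite (complex_of_real -` B)" by (rule finite_vimageI) (simp add: inj_on_def)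
  moreover have "infinite {0::real<..}" by (rule infinite_Ioi)
  ultimately have "\<not> {0<..} \<subseteq> complex_of_real -` B" using finite_subset by blast
  then obtain s :: real where s: "0 < s" "of_real s \<notin> B" by auto
  have ne: "poly q (of_real s) \<noteq> 0" if "q \<in> Q" for q using s(2) that by (auto simp: B_def)
  show thesis
  proof (rule that[OF s(1)])
    show "inj_on (\<lambda>i. \<Sum>k\<in>I. a i k * of_real s ^ k) I"
    proof (rule inj_onI, rule ccontr)
      fix i i' assume i: "i \<in> I" "i' \<in> I" "i \<noteq> i'"
        and eq: "(\<Sum>k\<in>I. a i k * of_real s ^ k) = (\<Sum>k\<in>I. a i' k * of_real s ^ k)"
      obtain k where "k \<in> I" "a i k \<noteq> a i' k" using dist i by blast
      then have "P i \<noteq> P i'" using coeff by metis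
      then have "P i - P i' \<in> Q" using i by (auto simp: Q_def)
      moreover have "poly (P i - P i') (of_real s) = 0" using eq by (simp add: P)
      ultimately show False using ne by blast
    qed
    fix i assume i: "i \<in> I" and zero: "(\<Sum>k\<in>I. a i k * of_real s ^ k) = 0"
    have "P i = 0"
    proof (rule ccontr)
      assume "P i \<noteq> 0"
      then have "P i \<in> Q" using i by (auto simp: Q_def)
      moreover have "poly (P i) (of_real s) = 0" using zero by (simp add: P)
      ultimately show False using ne by blast
    qed
    then show "\<forall>k\<in>I. a i k = 0" using coeff[of _ i] by simp
  qed
qed

text \<open>By \<open>psd_on_diff_rank_one\<close> the matrix dominates \<open>u u\<^sup>*\<close> for a multiple \<open>u\<close> of \<open>a w\<close>, and the
  powers are monotone. The vector \<open>w\<close> of powers of a generic \<open>s > 0\<close> makes the entries of \<open>u\<close> distinct, and zero only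
  for zero rows. It is positive, so \<open>u\<close> is nonnegative whenever \<open>a\<close> is.\<close>

lemma pd_on_positive_power_sum:
  fixes a :: "nat \<Rightarrow> nat \<Rightarrow> complex"
  assumes "finite I" "finite K" "card K = card I" "inj_on n K" "\<And>j. j \<in> K \<Longrightarrow> 0 < c j"
    and psd: "psd_on I a"
    and dist: "\<And>i i'. i \<in> I \<Longrightarrow> i' \<in> I \<Longrightarrow> i \<noteq> i' \<Longrightarrow> \<exists>k\<in>I. a i k \<noteq> a i' k"
    and zero: "\<And>i. i \<in> I \<Longrightarrow> \<forall>k\<in>I. a i k = 0 \<Longrightarrow> \<exists>j\<in>K. n j = 0"
    and expo: "\<And>j. j \<in> K \<Longrightarrow> n j \<in> \<nat> \<or> nonneg_entries I a \<and> 0 \<le> n j \<and> real (card I) - 1 \<le> n j"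
    and dom: "nonneg_entries I a \<or> (\<exists>k N. K = {..<N} \<and> (\<forall>j<N. n j = real (k + j)))"
  shows "pd_on I (\<lambda>i k. \<Sum>j\<in>K. of_real (c j) * cpow (a i k) (n j))"
proof -
  obtain s :: real where s: "0 < s" "inj_on (\<lambda>i. \<Sum>k\<in>I. a i k * of_real s ^ k) I"
    and s0: "\<And>i. i \<in> I \<Longrightarrow> (\<Sum>k\<in>I. a i k * of_real s ^ k) = 0 \<Longrightarrow> \<forall>k\<in>I. a i k = 0"
    using separating_powers[of I a] assms(1) dist by blast
  define w where "w k = complex_of_real s ^ k" for k
  define q where "q = Re (qform I a w)"
  define u where "u i = (\<Sum>k\<in>I. a i k * w k) / of_real (sqrt q)" for i
  define b where "b i k = u i * cnj (u k)" for i k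
  have sub: "psd_on I (\<lambda>i k. a i k - b i k)"
    unfolding b_def u_def q_def by (rule psd_on_diff_rank_one(1)[OF assms(1) psd])
  have vanish: "(\<Sum>k\<in>I. a i k * w k) = 0" if "q = 0" "i \<in> I" for i
    using psd_on_diff_rank_one(2)[OF assms(1) psd] that unfolding q_def by blast
  have q0: "0 \<le> q" using psd by (simp add: q_def psd_on_def)
  \<comment> \<open>if \<open>q = 0\<close>, then \<open>a w = 0\<close> has distinct entries, so there is at most one row\<close>
  have u_inj: "inj_on u I"
  proof (cases "q = 0")
    case True
    show ?thesis
    proof (rule inj_onI)
      fix i i' assume i: "i \<in> I" "i' \<in> I"
      then have "(\<Sum>k\<in>I. a i k * w k) = (\<Sum>k\<in>I. a i' k * w k)" using vanish[OF True] by simp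
      then show "i = i'" using s(2) i unfolding w_def by (auto dest: inj_onD)
    qed
  next
    case False
    then show ?thesis using s(2) q0 unfolding u_def w_def by (auto simp: inj_on_def)
  qed
  have u_zero: "\<exists>j\<in>K. n j = 0" if "i \<in> I" "u i = 0" for i
  proof -
    have "(\<Sum>k\<in>I. a i k * w k) = 0" using that vanish[of i] q0 by (cases "q = 0") (auto simp: u_def)
    then show ?thesis using s0 that(1) zero unfolding w_def by blast
  qed
  have u_nn: "u i \<in> \<real>\<^sub>\<ge>\<^sub>0" if "nonneg_entries I a" "i \<in> I" for i
  proof -
    have "\<forall>k\<in>I. a i k = of_real (Re (a i k)) \<and> 0 \<le> Re (a i k)"
      using that by (auto simp: nonneg_entries_def complex_nonneg_Reals_iff complex_eq_iff)
    then have "(\<Sum>k\<in>I. a i k * w k) = of_real (\<Sum>k\<in>I. Re (a i k) * s ^ k)" "0 \<le> (\<Sum>k\<in>I. Re (a i k) * s ^ k)"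
      using s(1) by (auto simp: w_def intro!: sum.cong sum_nonneg)
    moreover from this(1) have "u i = of_real ((\<Sum>k\<in>I. Re (a i k) * s ^ k) / sqrt q)"
      unfolding u_def by (simp only: of_real_divide)
    ultimately show ?thesis using q0 by (simp only: nonneg_Reals_of_real_iff) simp
  qed
  have bn: "nonneg_entries I b" if "nonneg_entries I a"
    unfolding b_def[abs_def] using u_nn[OF that] by (rule nonneg_entries_rank_one)
  have "pd_on I (\<lambda>i k. \<Sum>j\<in>K. of_real (c j) * cpow (b i k) (n j))"
    unfolding b_def
  proof (rule pd_on_positive_power_sum_rank_one[OF assms(1) _ assms(2)])
    show "cpow (u i * cnj (u k)) (n j) = cpow (u i) (n j) * cnj (cpow (u k) (n j))"
      if "i \<in> I" "k \<in> I" "j \<in> K" for i k j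
      using expo[OF that(3)] u_nn that by (intro cpow_rank_one) blast
    show "\<exists>x. \<forall>i\<in>I. (\<Sum>j\<in>K. x j * cpow (u i) (n j)) = (if i = p then 1 else 0)" if "p \<in> I" for p
      by (rule unisolvent_on[OF assms(1-4) u_inj that u_zero]) (use dom u_nn in blast)+
  qed (use assms(5) in auto)
  moreover have "psd_on I (\<lambda>i k. \<Sum>j\<in>K. of_real (c j) * (cpow (a i k) (n j) - cpow (b i k) (n j)))"
  proof (rule psd_on_sum, rule psd_on_scale)
    fix j assume j: "j \<in> K"
    show "0 \<le> c j" using assms(5)[OF j] by simp
    have "psd_on I b" unfolding b_def[abs_def] by (rule psd_on_rank_one)
    then show "psd_on I (\<lambda>i k. cpow (a i k) (n j) - cpow (b i k) (n j))"
      using expo[OF j] bn by (intro psd_on_cpow_mono[OF assms(1) psd _ sub]) auto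
  qed
  ultimately have "pd_on I (\<lambda>i k. (\<Sum>j\<in>K. of_real (c j) * cpow (b i k) (n j))
      + (\<Sum>j\<in>K. of_real (c j) * (cpow (a i k) (n j) - cpow (b i k) (n j))))"
    by (rule pd_on_add_psd)
  moreover have "(\<Sum>j\<in>K. of_real (c j) * cpow (b i k) (n j))
      + (\<Sum>j\<in>K. of_real (c j) * (cpow (a i k) (n j) - cpow (b i k) (n j)))
      = (\<Sum>j\<in>K. of_real (c j) * cpow (a i k) (n j))" for i k
    unfolding sum.distrib[symmetric] by (simp add: algebra_simps)
  ultimately show ?thesis by (simp only:)
qed

text \<open>The strict inequality for \<open>c'\<close> leaves room to set aside a small multiple of the part with
  positive coefficients: shrinking these to \<open>(1 - \<epsilon>) c j\<close> multiplies the threshold by \<open>1 / (1 - \<epsilon>)\<close>.\<close>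

lemma pd_on_power_sum_split:
  assumes "finite K" and c: "\<And>j. j \<in> K \<Longrightarrow> 0 < c j"
    and T: "0 < power_threshold K n M c \<rho>" "- inverse (power_threshold K n M c \<rho>) < c'"
    and pd: "pd_on I (\<lambda>i k. \<Sum>j\<in>K. of_real (c j) * cpow (a i k) (n j))"
    and psd: "\<And>d. (\<And>j. j \<in> K \<Longrightarrow> 0 < d j) \<Longrightarrow> - 1 \<le> c' * power_threshold K n M d \<rho> \<Longrightarrow>
      psd_on I (\<lambda>i k. power_sum K n M d c' (a i k))"
  shows "pd_on I (\<lambda>i k. power_sum K n M c c' (a i k))"
proof -
  define T where "T = power_threshold K n M c \<rho>"
  have "0 < 1 + c' * T" using T unfolding T_def[symmetric] by (simp add: field_simps)
  define \<epsilon> where "\<epsilon> = min (1 / 2) (1 + c' * T)"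
  have \<epsilon>: "0 < \<epsilon>" "\<epsilon> < 1" "\<epsilon> \<le> 1 + c' * T" using \<open>0 < 1 + c' * T\<close> by (auto simp: \<epsilon>_def)
  have thr: "power_threshold K n M (\<lambda>j. (1 - \<epsilon>) * c j) \<rho> = T / (1 - \<epsilon>)"
    unfolding T_def power_threshold_def sum_divide_distrib by (intro sum.cong refl) simp
  have "psd_on I (\<lambda>i k. power_sum K n M (\<lambda>j. (1 - \<epsilon>) * c j) c' (a i k))"
  proof (rule psd)
    show "- 1 \<le> c' * power_threshold K n M (\<lambda>j. (1 - \<epsilon>) * c j) \<rho>"
      unfolding thr using \<epsilon> by (simp add: field_simps)
  qed (use c \<epsilon> in simp)
  from pd_on_add_psd[OF pd_on_scale[OF \<epsilon>(1) pd] this]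
  moreover have "of_real \<epsilon> * (\<Sum>j\<in>K. of_real (c j) * cpow z (n j)) + power_sum K n M (\<lambda>j. (1 - \<epsilon>) * c j) c' z
      = power_sum K n M c c' z" for z
    unfolding power_sum_def sum_distrib_left add.assoc[symmetric] sum.distrib[symmetric]
    by (simp add: algebra_simps)
  ultimately show ?thesis by (simp only:)
qed

lemma pd_on_power_sum_above_threshold:
  fixes a :: "nat \<Rightarrow> nat \<Rightarrow> complex"
  assumes "finite I" "finite K" "card K = card I" "I \<noteq> {}" "inj_on n K" and nM: "\<And>j. j \<in> K \<Longrightarrow> n j < M"
    and c: "\<And>j. j \<in> K \<Longrightarrow> 0 < c j" and "0 < \<rho>" and psd: "psd_on I a"
    and diag: "\<And>i. i \<in> I \<Longrightarrow> cmod (a i i) \<le> \<rho>"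
    and T: "0 < power_threshold K n M c \<rho>" "- inverse (power_threshold K n M c \<rho>) < c'"
    and dist: "\<And>i i'. i \<in> I \<Longrightarrow> i' \<in> I \<Longrightarrow> i \<noteq> i' \<Longrightarrow> \<exists>k\<in>I. a i k \<noteq> a i' k"
    and zero: "\<And>i. i \<in> I \<Longrightarrow> \<forall>k\<in>I. a i k = 0 \<Longrightarrow> \<exists>j\<in>K. n j = 0"
    and adm: "nonneg_entries I a \<and> (\<forall>\<alpha>\<in>insert M (n ` K). \<alpha> \<in> \<nat> \<or> real (card I) - 1 \<le> \<alpha>)
      \<or> M \<in> \<nat> \<and> (\<exists>k N. K = {..<N} \<and> (\<forall>j<N. n j = real (k + j)))"
  shows "pd_on I (\<lambda>i k. power_sum K n M c c' (a i k))"
proof (rule pd_on_power_sum_split[OF assms(2) c T])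
  have "card I \<ge> 1" using assms(1,4) by (simp add: Suc_le_eq card_gt_0_iff)
  then show "pd_on I (\<lambda>i k. \<Sum>j\<in>K. of_real (c j) * cpow (a i k) (n j))"
    using adm by (intro pd_on_positive_power_sum[OF assms(1-3,5) c psd dist zero]) (auto simp del: of_nat_add)
  fix d assume d: "\<And>j. j \<in> K \<Longrightarrow> 0 < d j" "- 1 \<le> c' * power_threshold K n M d \<rho>"
  have "admissible I a K n M"
    using adm unfolding admissible_def consecutive_def
    by (metis atLeast0LessThan diff_zero lessThan_iff)
  then show "psd_on I (\<lambda>i k. power_sum K n M d c' (a i k))"
    by (intro psd_on_power_sum[OF assms(1-3,5) nM d(1) assms(8) psd diag d(2)])
qed

lemma pd_on_power_sum_above_threshold_rank_one:
  fixes u :: "nat \<Rightarrow> complex"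
  assumes "finite I" "finite K" "card K = card I" "inj_on n K" and nM: "\<And>j. j \<in> K \<Longrightarrow> n j < M"
    and c: "\<And>j. j \<in> K \<Longrightarrow> 0 < c j" and "0 < \<rho>"
    and T: "0 < power_threshold K n M c \<rho>" "- inverse (power_threshold K n M c \<rho>) < c'"
    and u: "\<And>i. i \<in> I \<Longrightarrow> u i \<in> \<real>\<^sub>\<ge>\<^sub>0" "\<And>i. i \<in> I \<Longrightarrow> (cmod (u i))\<^sup>2 \<le> \<rho>" "inj_on u I"
    and zero: "\<And>i. i \<in> I \<Longrightarrow> u i = 0 \<Longrightarrow> (\<exists>j\<in>K. n j = 0) \<and> (\<forall>j\<in>K. 0 \<le> n j)"
  shows "pd_on I (\<lambda>i k. power_sum K n M c c' (u i * cnj (u k)))"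
proof (rule pd_on_power_sum_split[OF assms(2) c T])
  show "pd_on I (\<lambda>i k. \<Sum>j\<in>K. of_real (c j) * cpow (u i * cnj (u k)) (n j))"
  proof (rule pd_on_positive_power_sum_rank_one[OF assms(1) c assms(2)])
    show "cpow (u i * cnj (u k)) (n j) = cpow (u i) (n j) * cnj (cpow (u k) (n j))"
      if "i \<in> I" "k \<in> I" "j \<in> K" for i k j
      using u(1) that by (intro cpow_rank_one) blast
    show "\<exists>x. \<forall>i\<in>I. (\<Sum>j\<in>K. x j * cpow (u i) (n j)) = (if i = p then 1 else 0)" if "p \<in> I" for p
      by (rule unisolvent_on[OF assms(1-4) u(3) that]) (use zero u(1) in blast)+
  qed
  fix d assume d: "\<And>j. j \<in> K \<Longrightarrow> 0 < d j" "- 1 \<le> c' * power_threshold K n M d \<rho>"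
  obtain x where "\<And>i. i \<in> I \<Longrightarrow> cpow (u i) M = (\<Sum>j\<in>K. x j * cpow (u i) (n j))"
    "\<And>j. j \<in> K \<Longrightarrow> (cmod (x j))\<^sup>2 \<le> (lagrange_abs K n M j)\<^sup>2 * \<rho> powr (M - n j)"
  proof -
    have dom: "(\<forall>i\<in>I. u i \<in> \<real>\<^sub>\<ge>\<^sub>0 \<and> (u i = 0 \<longrightarrow> (\<forall>j\<in>K. 0 \<le> n j))) \<or> consecutive K n M"
      using u(1) zero by blast
    have le: "card I \<le> card K" using assms(3) by simp
    show thesis
      by (rule interpolation_on[OF assms(1,2) le assms(4) nM assms(7) u(2) dom], assumption+, rule that)
  qed
  then show "psd_on I (\<lambda>i k. power_sum K n M d c' (u i * cnj (u k)))"
    using u(1) by (intro psd_on_power_sum_rank_one[OF assms(1,2) d] cpow_rank_one) blast+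
qed

section \<open>The threshold as a ratio of Vandermonde determinants\<close>

lemma vdm_snoc: "vdm (xs @ [y]) = vdm xs * prod_list (map (\<lambda>x. y - x) xs)"
proof -
  have "prod_list (map (\<lambda>x. y - x) xs) = (\<Prod>k<length xs. y - xs ! k)"
    by (simp add: prod.list_conv_set_nth atLeast0LessThan)
  then show ?thesis by (simp add: vdm_def nth_append)
qed

text \<open>The squares absorb the signs that come from moving \<open>y\<close> to the end of the list.\<close>

lemma vdm_remove:
  "(vdm (xs @ y # ys))\<^sup>2 = (vdm (xs @ ys))\<^sup>2 * (prod_list (map (\<lambda>x. y - x) (xs @ ys)))\<^sup>2"
proof (induction ys rule: rev_induct)
  case Nil
  show ?case by (simp add: vdm_snoc power_mult_distrib)
next
  case (snoc z ys)
  have "(vdm (xs @ y # ys @ [z]))\<^sup>2 = (vdm (xs @ y # ys))\<^sup>2 * (prod_list (map (\<lambda>x. z - x) (xs @ y # ys)))\<^sup>2"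
    using vdm_snoc[of "xs @ y # ys" z] by (simp add: power_mult_distrib)
  moreover have "(vdm (xs @ ys @ [z]))\<^sup>2 = (vdm (xs @ ys))\<^sup>2 * (prod_list (map (\<lambda>x. z - x) (xs @ ys)))\<^sup>2"
    using vdm_snoc[of "xs @ ys" z] by (simp add: power_mult_distrib)
  ultimately show ?case
    using snoc.IH by (simp add: power_mult_distrib power2_commute[of z y] mult_ac)
qed

lemma vdm_nonzero: "distinct xs \<Longrightarrow> vdm xs \<noteq> 0"
  by (induction xs rule: rev_induct) (auto simp: vdm_snoc vdm_def[of "[]"] prod_list_zero_iff)

text \<open>The determinants of \<open>exps\<close> and \<open>exps_omit\<close> share the factor for the exponents other than \<open>n j\<close>;
  what remains are the products of differences with \<open>n j\<close> and with \<open>M\<close>.\<close>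

lemma threshold_eq:
  assumes "inj_on n {..<N}"
  shows "threshold N n M c \<rho> = power_threshold {..<N} n M c \<rho>"
  unfolding threshold_def power_threshold_def
proof (intro sum.cong refl)
  fix j assume "j \<in> {..<N}"
  then have j: "j < N" by simp
  define L where "L = [0..<j] @ [Suc j..<N]"
  have L: "distinct L" "set L = {..<N} - {j}" using j by (auto simp: L_def)
  have prod_L: "prod_list (map (\<lambda>x. y - x) (map n L)) = (\<Prod>k\<in>{..<N} - {j}. y - n k)" for y
    using prod.distinct_set_conv_list[OF L(1), of "\<lambda>k. y - n k"] L(2) by (simp add: o_def)
  have "[0..<N] = [0..<j] @ j # [Suc j..<N]"
    using j by (metis le_add_diff_inverse less_imp_le_nat upt_add_eq_append upt_conv_Cons zero_le)
  then have "exps N n = map n [0..<j] @ n j # map n [Suc j..<N]" by (simp add: exps_def)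
  then have e: "(vdm (exps N n))\<^sup>2 = (vdm (map n L))\<^sup>2 * (\<Prod>k\<in>{..<N} - {j}. n j - n k)\<^sup>2"
    using vdm_remove[of "map n [0..<j]" "n j" "map n [Suc j..<N]"] prod_L[of "n j"] by (simp add: L_def)
  have o: "(vdm (exps_omit N n M j))\<^sup>2 = (vdm (map n L))\<^sup>2 * (\<Prod>k\<in>{..<N} - {j}. M - n k)\<^sup>2"
    unfolding exps_omit_def L_def[symmetric] vdm_snoc prod_L by (simp add: power_mult_distrib)
  have "vdm (map n L) \<noteq> 0"
    using L inj_on_subset[OF assms, of "set L"] by (intro vdm_nonzero) (auto simp: distinct_map)
  moreover have "(lagrange_abs {..<N} n M j)\<^sup>2
      = (\<Prod>k\<in>{..<N} - {j}. M - n k)\<^sup>2 / (\<Prod>k\<in>{..<N} - {j}. n j - n k)\<^sup>2"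
    unfolding lagrange_abs_def prod_dividef power_divide by (simp flip: abs_prod)
  ultimately have "(vdm (exps_omit N n M j))\<^sup>2 / (vdm (exps N n))\<^sup>2 = (lagrange_abs {..<N} n M j)\<^sup>2"
    unfolding e o by simp
  then show "(vdm (exps_omit N n M j))\<^sup>2 / (vdm (exps N n))\<^sup>2 * (\<rho> powr (M - n j) / c j)
      = (lagrange_abs {..<N} n M j)\<^sup>2 * (\<rho> powr (M - n j) / c j)" by simp
qed

section \<open>Matrices\<close>

lemma mat_adjoint_eq_iff_herm_on:
  assumes "A \<in> carrier_mat N N"
  shows "mat_adjoint A = A \<longleftrightarrow> herm_on {..<N} (\<lambda>i k. A $$ (i, k))"
proof -
  have "mat_adjoint A $$ (i, k) = cnj (A $$ (k, i))" if "i < N" "k < N" for i k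
    using assms that by (simp add: mat_adjoint_def mat_of_rows_index)
  moreover have "mat_adjoint A \<in> carrier_mat N N" using assms by (auto simp: mat_adjoint_def)
  ultimately have "mat_adjoint A = A \<longleftrightarrow> (\<forall>i<N. \<forall>k<N. cnj (A $$ (k, i)) = A $$ (i, k))"
    using assms by (auto simp: mat_eq_iff)
  then show ?thesis by (auto simp: herm_on_def)
qed

lemma qform_mat:
  assumes "A \<in> carrier_mat N N" "v \<in> carrier_vec N"
  shows "(A *\<^sub>v v) \<bullet>c v = qform {..<N} (\<lambda>i k. A $$ (i, k)) (\<lambda>i. v $ i)"
  using assms by (simp add: scalar_prod_def qform_def sum_distrib_right atLeast0LessThan)

lemma psd_on_of_pos_semidef:
  assumes "pos_semidef N A"
  shows "psd_on {..<N} (\<lambda>i k. A $$ (i, k))"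
proof -
  have A: "A \<in> carrier_mat N N" "herm_on {..<N} (\<lambda>i k. A $$ (i, k))"
    using assms mat_adjoint_eq_iff_herm_on unfolding pos_semidef_def hermitian_mat_def by auto
  moreover have "0 \<le> Re (qform {..<N} (\<lambda>i k. A $$ (i, k)) v)" for v
  proof -
    have "0 \<le> (A *\<^sub>v vec N v) \<bullet>c vec N v"
      using assms unfolding pos_semidef_def by simp
    also have "\<dots> = qform {..<N} (\<lambda>i k. A $$ (i, k)) v"
      using qform_mat[OF A(1), of "vec N v"] by (simp add: qform_def)
    finally show ?thesis by (simp add: less_eq_complex_def)
  qed
  ultimately show ?thesis by (simp add: psd_on_def)
qed

lemma pos_def_of_pd_on:
  assumes "A \<in> carrier_mat N N" "pd_on {..<N} (\<lambda>i k. A $$ (i, k))"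
  shows "pos_def N A"
proof -
  have herm: "cnj (A $$ (i, k)) = A $$ (k, i)" if "i < N" "k < N" for i k
    using assms(2) that unfolding pd_on_def herm_on_def by blast
  have "0 < (A *\<^sub>v v) \<bullet>c v" if v: "v \<in> carrier_vec N" "v \<noteq> 0\<^sub>v N" for v
  proof -
    let ?q = "qform {..<N} (\<lambda>i k. A $$ (i, k)) (\<lambda>i. v $ i)"
    have "cnj ?q = (\<Sum>i<N. \<Sum>k<N. A $$ (k, i) * v $ i * cnj (v $ k))"
      unfolding qform_def cnj_sum by (intro sum.cong refl) (simp add: herm)
    also have "\<dots> = ?q" unfolding qform_def by (rule sum.swap)
    finally have "Im ?q = 0" by (simp add: complex_eq_iff)
    moreover have "\<exists>i\<in>{..<N}. v $ i \<noteq> 0" using v by (metis carrier_vecD eq_vecI index_zero_vec lessThan_iff)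
    then have "0 < Re ?q" using assms(2) unfolding pd_on_def by blast
    ultimately show ?thesis using qform_mat[OF assms(1) v(1)] by (simp add: less_complex_def)
  qed
  moreover have "mat_adjoint A = A"
    using assms mat_adjoint_eq_iff_herm_on unfolding pd_on_def by blast
  ultimately show ?thesis using assms(1) unfolding pos_def_def hermitian_mat_def by blast
qed

text \<open>Two different columns span a space of dimension at most one, hence are linearly dependent,
  and the relation can be solved for column \<open>k\<close> because column \<open>p\<close> is not zero.\<close>

lemma rank_le_1_cols:
  fixes A :: "complex mat"
  assumes A: "A \<in> carrier_mat N N" and rank: "vec_space.rank N A \<le> 1"
    and "k < N" "p < N" "i < N" "A $$ (i, p) \<noteq> 0"
  obtains z where "\<And>i. i < N \<Longrightarrow> A $$ (i, k) = z * A $$ (i, p)"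
proof (cases "col A k = col A p")
  case True
  have "A $$ (i, k) = 1 * A $$ (i, p)" if "i < N" for i
    using arg_cong[OF True, of "\<lambda>v. v $ i"] that A assms(3,4) by simp
  then show thesis by (rule that)
next
  case False
  interpret vec_space "TYPE(complex)" N .
  define U where "U = {col A k, col A p}"
  have U: "U \<subseteq> set (cols A)" "U \<subseteq> carrier_vec N"
    using A assms(3,4) by (auto simp: U_def cols_def)
  have "\<not> lin_indpt U"
  proof
    assume "lin_indpt U"
    from rank_ge_card_indpt[OF A U(1) this] show False using rank False by (simp add: U_def)
  qed
  then obtain B b v where B: "finite B" "B \<subseteq> U" "lincomb b B = 0\<^sub>v N" "v \<in> B" "b v \<noteq> 0"
    unfolding lin_dep_def by auto
  define g where "g x = (if x \<in> B then b x else 0)" for x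
  have g: "g (col A k) * A $$ (i, k) + g (col A p) * A $$ (i, p) = 0" if "i < N" for i
  proof -
    have "0 = (\<Sum>x\<in>B. b x * x $ i)"
      using lincomb_index[OF that, of B b] B(2,3) U(2) that by auto
    also have "\<dots> = (\<Sum>x\<in>U. g x * x $ i)"
      using B(2) by (intro sum.mono_neutral_cong_left) (auto simp: g_def U_def)
    also have "\<dots> = g (col A k) * A $$ (i, k) + g (col A p) * A $$ (i, p)"
      using False that A assms(3,4) by (simp add: U_def)
    finally show ?thesis ..
  qed
  have "g (col A k) \<noteq> 0"
  proof
    assume 0: "g (col A k) = 0"
    then have "v = col A p" "g v \<noteq> 0" using B(2,4,5) by (auto simp: U_def g_def)
    then show False using g[OF assms(5)] 0 assms(6) by simp
  qed
  then have "A $$ (i, k) = (- g (col A p) / g (col A k)) * A $$ (i, p)" if "i < N" for i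
    using g[OF that] by (simp add: field_simps add_eq_0_iff)
  then show thesis by (rule that)
qed

text \<open>Peeling at an index with nonzero diagonal entry gives the factorization, as each column is a
  multiple of the one peeled off. If the diagonal is zero, so is the matrix.\<close>

lemma psd_rank_one_factorization:
  fixes A :: "complex mat"
  assumes A: "A \<in> carrier_mat N N" and rank: "vec_space.rank N A \<le> 1"
    and psd: "psd_on {..<N} (\<lambda>i k. A $$ (i, k))" and nn: "nonneg_entries {..<N} (\<lambda>i k. A $$ (i, k))"
  obtains u where "\<And>i k. i < N \<Longrightarrow> k < N \<Longrightarrow> A $$ (i, k) = u i * cnj (u k)"
    and "\<And>i. i < N \<Longrightarrow> u i \<in> \<real>\<^sub>\<ge>\<^sub>0"
proof (cases "\<exists>p<N. A $$ (p, p) \<noteq> 0")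
  case False
  have "A $$ (i, k) = 0" if "i < N" "k < N" for i k
    using psd_on_peel(2)[OF finite_lessThan psd, of k _ i] that False by auto
  then show thesis using that[of "\<lambda>_. 0"] by simp
next
  case True
  then obtain p where p: "p < N" "A $$ (p, p) \<noteq> 0" by blast
  then have pin: "p \<in> {..<N}" by simp
  define u where "u i = A $$ (i, p) / of_real (sqrt (Re (A $$ (p, p))))" for i
  note peel = psd_on_peel[OF finite_lessThan psd pin u_def]
  have up: "u p \<noteq> 0" using peel(2)[OF pin] p(2) by auto
  have "A $$ (i, k) = u i * cnj (u k)" if ik: "i < N" "k < N" for i k
  proof -
    obtain z where z: "\<And>i. i < N \<Longrightarrow> A $$ (i, k) = z * A $$ (i, p)"
      using rank_le_1_cols[OF A rank ik(2) p(1) p(1) p(2)] by blast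
    have "u p * cnj (u k) = z * A $$ (p, p)"
      using peel(3)[of k] z[OF p(1)] ik by simp
    also have "\<dots> = u p * (z * cnj (u p))" using peel(2)[OF pin] by simp
    finally have "u p * cnj (u k) = u p * (z * cnj (u p))" .
    then have "cnj (u k) = z * cnj (u p)" using up by simp
    then show ?thesis using z[OF ik(1)] peel(2)[of i] ik by simp
  qed
  moreover have "u i \<in> \<real>\<^sub>\<ge>\<^sub>0" if "i < N" for i
    unfolding u_def using nonneg_entries_peel[OF finite_lessThan psd nn pin] that by simp
  ultimately show thesis by (rule that)
qed

theorem theorem1p3:
  fixes N :: nat and \<rho> :: real and n :: "nat \<Rightarrow> real" and M :: real
    and c :: "nat \<Rightarrow> real" and c' :: real
    and P0 :: "complex mat set" and A :: "complex mat"
  assumes "N \<ge> 1" and "\<rho> > 0"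
    and "strict_mono_on {..<N} n" and "n (N - 1) < M"
    and "setting1 N \<rho> P0 \<or> setting2 N \<rho> n M P0 \<or> setting3 N \<rho> n M P0 \<or> setting4 N \<rho> n M P0"
    and "\<forall>j<N. c j > 0"
    and "c' > - inverse (threshold N n M c \<rho>)"
    and "A \<in> P0"
    and "distinct (Matrix.rows A)"
    and "0\<^sub>v N \<in> set (Matrix.rows A) \<Longrightarrow> n 0 = 0"
  shows "pos_def N (map_mat (fewnomial N n M c c') A)"
proof -
  define a where "a i k = A $$ (i, k)" for i k
  have inj: "inj_on n {..<N}" by (rule strict_mono_on_imp_inj_on[OF assms(3)])
  have nM: "n j < M" if "j \<in> {..<N}" for j
  proof -
    have "n j \<le> n (N - 1)"
      using strict_mono_on_leD[OF assms(3), of j "N - 1"] that assms(1) by auto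
    then show ?thesis using assms(4) by simp
  qed
  have c: "0 < c j" if "j \<in> {..<N}" for j using assms(6) that by simp
  have card: "card {..<N} = card {..<N}" ..
  have ne: "{..<N} \<noteq> {}" using assms(1) by (simp add: lessThan_empty_iff)
  have T: "0 < power_threshold {..<N} n M c \<rho>" by (rule power_threshold_pos[OF _ ne inj nM c assms(2)]) simp
  have c': "- inverse (power_threshold {..<N} n M c \<rho>) < c'"
    using assms(7) unfolding threshold_eq[OF inj] .
  have "\<exists>k D. A \<in> psd_rank N k D"
    using assms(5,8) unfolding setting1_def setting2_def setting3_def setting4_def by blast
  then have sd: "pos_semidef N A" unfolding psd_rank_def by blast
  then have A: "A \<in> carrier_mat N N" unfolding pos_semidef_def hermitian_mat_def by blast
  have psd: "psd_on {..<N} a" unfolding a_def[abs_def] by (rule psd_on_of_pos_semidef[OF sd])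
  have entry: "a i k \<in> D" if "elements_mat A \<subseteq> D" "i \<in> {..<N}" "k \<in> {..<N}" for i k D
    using elements_matI[OF A, of i k "a i k"] that by (auto simp: a_def)
  have dist: "\<exists>k\<in>{..<N}. a i k \<noteq> a i' k" if "i \<in> {..<N}" "i' \<in> {..<N}" "i \<noteq> i'" for i i'
  proof (rule ccontr)
    assume "\<not> ?thesis"
    then have "row A i = row A i'" using A that by (intro eq_vecI) (auto simp: a_def)
    then have "Matrix.rows A ! i = Matrix.rows A ! i'" using A that by simp
    then show False using nth_eq_iff_index_eq[OF assms(9), of i i'] A that by simp
  qed
  have zero: "n 0 = 0" if "i \<in> {..<N}" "\<forall>k\<in>{..<N}. a i k = 0" for i
  proof (rule assms(10))
    have "row A i = 0\<^sub>v N" using A that by (intro eq_vecI) (auto simp: a_def)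
    moreover have "row A i \<in> set (Matrix.rows A)" using A that by (auto simp: Matrix.rows_def)
    ultimately show "0\<^sub>v N \<in> set (Matrix.rows A)" by simp
  qed
  have zero': "\<exists>j\<in>{..<N}. n j = 0" if "i \<in> {..<N}" "\<forall>k\<in>{..<N}. a i k = 0" for i
    using zero[OF that] assms(1) by (intro bexI[of _ 0]) auto
  have conclude: ?thesis if pd: "pd_on {..<N} (\<lambda>i k. power_sum {..<N} n M c c' (a i k))"
  proof (rule pos_def_of_pd_on)
    show "map_mat (fewnomial N n M c c') A \<in> carrier_mat N N" using A by simp
    show "pd_on {..<N} (\<lambda>i k. map_mat (fewnomial N n M c c') A $$ (i, k))"
      by (rule pd_on_cong[THEN iffD1, OF _ pd]) (use A in \<open>simp add: a_def fewnomial_def power_sum_def\<close>)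
  qed
  have rank_one: ?thesis if P: "A \<in> psd_rank N 1 (complex_of_real ` {0..\<rho>})"
    and nn: "(\<forall>i<N. a i i \<noteq> 0) \<or> (\<forall>j<N. 0 \<le> n j)"
  proof -
    have el: "elements_mat A \<subseteq> complex_of_real ` {0..\<rho>}" and rank: "vec_space.rank N A \<le> 1"
      using P unfolding psd_rank_def by auto
    have "nonneg_entries {..<N} a"
      unfolding nonneg_entries_def using entry[OF el] by fastforce
    then obtain u where u: "\<And>i k. i < N \<Longrightarrow> k < N \<Longrightarrow> a i k = u i * cnj (u k)"
      "\<And>i. i < N \<Longrightarrow> u i \<in> \<real>\<^sub>\<ge>\<^sub>0"
      using psd_rank_one_factorization[OF A rank] psd unfolding a_def[abs_def] by blast
    have norm: "(cmod (u i))\<^sup>2 \<le> \<rho>" if "i \<in> {..<N}" for i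
    proof -
      have "(cmod (u i))\<^sup>2 = cmod (a i i)" using u(1)[of i i] that by (simp add: norm_mult power2_eq_square)
      then show ?thesis using entry[OF el that that] by auto
    qed
    have u_inj: "inj_on u {..<N}"
    proof (rule inj_onI, rule ccontr)
      fix i i' assume i: "i \<in> {..<N}" "i' \<in> {..<N}" "u i = u i'" "i \<noteq> i'"
      then show False using dist[OF i(1,2,4)] u(1) by simp
    qed
    have u_zero: "(\<exists>j\<in>{..<N}. n j = 0) \<and> (\<forall>j\<in>{..<N}. 0 \<le> n j)" if i: "i \<in> {..<N}" and "u i = 0" for i
    proof -
      have "\<forall>k\<in>{..<N}. a i k = 0" using u(1) that by simp
      then show ?thesis using zero'[OF i] nn i by auto
    qed
    have "pd_on {..<N} (\<lambda>i k. power_sum {..<N} n M c c' (u i * cnj (u k)))"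
      using u(2) by (intro pd_on_power_sum_above_threshold_rank_one[OF _ _ card inj nM c assms(2) T c' _ norm u_inj u_zero]) auto
    then have "pd_on {..<N} (\<lambda>i k. power_sum {..<N} n M c c' (a i k))"
      by (rule pd_on_cong[THEN iffD1, rotated]) (simp add: u(1))
    then show ?thesis by (rule conclude)
  qed
  show ?thesis using assms(5)
  proof (elim disjE)
    assume "setting1 N \<rho> P0"
    then have P: "A \<in> psd_rank N 1 (complex_of_real ` {0<..<\<rho>})" using assms(8) by (simp add: setting1_def)
    have "complex_of_real ` {0<..<\<rho>} \<subseteq> complex_of_real ` {0..\<rho>}" by (intro image_mono) auto
    then have "A \<in> psd_rank N 1 (complex_of_real ` {0..\<rho>})" using P unfolding psd_rank_def by blast
    moreover have "\<forall>i<N. a i i \<noteq> 0" using entry[of "complex_of_real ` {0<..<\<rho>}"] P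
      unfolding psd_rank_def by fastforce
    ultimately show ?thesis using rank_one by blast
  next
    assume "setting2 N \<rho> n M P0"
    then show ?thesis using assms(8) rank_one unfolding setting2_def by blast
  next
    assume s: "setting3 N \<rho> n M P0"
    then have el: "elements_mat A \<subseteq> complex_of_real ` {0..\<rho>}"
      using assms(8) unfolding setting3_def psd_rank_def by blast
    have diag: "cmod (a i i) \<le> \<rho>" if "i \<in> {..<N}" for i
      using entry[OF el that that] by auto
    have "nonneg_entries {..<N} a"
      unfolding nonneg_entries_def using entry[OF el] by fastforce
    moreover have "\<forall>\<alpha>\<in>insert M (n ` {..<N}). \<alpha> \<in> \<nat> \<or> real (card {..<N}) - 1 \<le> \<alpha>"
      using s unfolding setting3_def by auto
    ultimately show ?thesis
      by (intro conclude pd_on_power_sum_above_threshold[OF _ _ card ne inj nM c assms(2) psd diag T c' dist zero']) auto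
  next
    assume s: "setting4 N \<rho> n M P0"
    then have el: "elements_mat A \<subseteq> cball 0 \<rho>"
      using assms(8) unfolding setting4_def psd_rank_def by blast
    have diag: "cmod (a i i) \<le> \<rho>" if "i \<in> {..<N}" for i
      using entry[OF el that that] by auto
    obtain k where "n 0 = real k" using s unfolding setting4_def by (auto elim: Nats_cases)
    then have cons: "\<forall>j<N. n j = real (k + j)" using s unfolding setting4_def by auto
    have "0 < M" using nM[of 0] assms(1) \<open>n 0 = real k\<close> by simp
    then have "M \<in> \<nat>" using s unfolding setting4_def by (simp add: Nats_altdef2)
    then have "M \<in> \<nat> \<and> (\<exists>k N'. {..<N} = {..<N'} \<and> (\<forall>j<N'. n j = real (k + j)))" using cons by blast
    then show ?thesis
      by (intro conclude pd_on_power_sum_above_threshold[OF _ _ card ne inj nM c assms(2) psd diag T c' dist zero']) auto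
  qed
qed

end
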